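(* Suppose that for every $f\in L^\infty(0,\infty;H)$ the nudging filter $$\begin{aligned}\tfrac{dv}{dt}+\nu Av+B(v,v)&=f-\mu P_Nv+\mu P_Nu,\quad v(0)=v_0,\\ \tfrac{du}{dt}+\nu Au+B(u,u)&=f,\quad u(0)=u_0,\end{aligned}$$ has the synchronization property, i.e. there exist an increasing function $\mu_*:(0,\infty)\to(0,\infty)$, independent of $f$, and $N_*>0$ depending continuously on $\sup_t|f(t)|$ and $\nu$, such that $|v(t)-u(t)|\to0$ as $t\to\infty$ for every $N\ge N_*$, every $\mu\in[\mu_*(N_* ),\mu_*(N)]$ and all $u_0,v_0\in V$. Then the 2D Navier–Stokes equations have the finite determining modes property: for all $f_1,f_2\in L^\infty(0,\infty;H)$ there exists $N>0$ such that for all $u_0^1,u_0^2\in V$, the global strong solutions $u_j$ of $\frac{du_j}{dt}+\nu Au_j+B(u_j,u_j)=f_j$, $u_j(0)=u_0^j$, satisfy: if $|P_Nu_1(t)-P_Nu_2(t)|\to0$ and $|f_1(t)-f_2(t)|\to0$ as $t\to\infty$, then $|u_1(t)-u_2(t)|\to0$ as $t\to\infty$.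
   Context: Let $\Omega=[0,2\pi]^2$ with periodic boundary conditions. $H$ is the space of $2\pi$-periodic, divergence-free, mean-free vector fields in $L^2(\Omega)^2$, with inner product $(u,v)=\int_\Omega u\cdot v\,dx$ and norm $|u|=(u,u)^{1/2}$; $V$ is the subspace of $H$ consisting of fields in $H^1$, with norm $\|u\|=|\nabla u|$. $\mathbb P$ is the Leray projection, $A=-\mathbb P\Delta$ is the Stokes operator with domain $D(A)$, and $B(u,v)=\mathbb P((u\cdot\nabla)v)$. For real $N>0$, $P_N$ is the orthogonal projection onto the Fourier modes with wavenumbers $k\in\mathbb Z^2\setminus\{0\}$, $|k|\le N$. $\nu>0$ is the viscosity, $\mu>0$ the nudging parameter. Global strong solution: $C([0,T];V)\cap L^2(0,T;D(A))$ for every $T>0$; both systems above are globally well-posed in this sense. *)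

theory Defs
  imports "HOL-Analysis.Analysis"
begin

text \<open>
  Fourier representation on the torus [0,2pi]^2.  A (complex-coefficient) vector field is
  given by its Fourier coefficients: u(x) = Sum_k (u k) e^{i k.x}, with u k :: complex * complex
  (the two velocity components).  Wave vectors are k :: int * int.
\<close>

type_synonym field = "int \<times> int \<Rightarrow> complex \<times> complex"

definition knorm2 :: "int \<times> int \<Rightarrow> real" where
  "knorm2 k = real_of_int (fst k ^ 2 + snd k ^ 2)"

definition cnorm2 :: "complex \<times> complex \<Rightarrow> real" where
  "cnorm2 a = (cmod (fst a))\<^sup>2 + (cmod (snd a))\<^sup>2"

definition kdot :: "int \<times> int \<Rightarrow> complex \<times> complex \<Rightarrow> complex" where
  "kdot k a = of_int (fst k) * fst a + of_int (snd k) * snd a"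

definition pconj :: "complex \<times> complex \<Rightarrow> complex \<times> complex" where
  "pconj a = (cnj (fst a), cnj (snd a))"

text \<open>H: real-valued, mean-free, divergence-free, L^2 fields.\<close>
definition in_H :: "field \<Rightarrow> bool" where
  "in_H u \<longleftrightarrow> u (0,0) = (0,0)
     \<and> (\<forall>k. kdot k (u k) = 0)
     \<and> (\<forall>k. u (- k) = pconj (u k))
     \<and> (\<lambda>k. cnorm2 (u k)) summable_on UNIV"

definition in_V :: "field \<Rightarrow> bool" where
  "in_V u \<longleftrightarrow> in_H u \<and> (\<lambda>k. knorm2 k * cnorm2 (u k)) summable_on UNIV"

text \<open>|u| = L^2 norm on [0,2pi]^2 (Parseval)\<close>
definition Hnorm :: "field \<Rightarrow> real" where
  "Hnorm u = sqrt ((2 * pi)\<^sup>2 * (\<Sum>\<^sub>\<infinity>k. cnorm2 (u k)))"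

definition Vnorm :: "field \<Rightarrow> real" where
  "Vnorm u = sqrt ((2 * pi)\<^sup>2 * (\<Sum>\<^sub>\<infinity>k. knorm2 k * cnorm2 (u k)))"

text \<open>|Au|^2 as an extended nonnegative real (infinite iff u is not in D(A))\<close>
definition DAnorm2 :: "field \<Rightarrow> ennreal" where
  "DAnorm2 u = (2 * pi)\<^sup>2 * (\<Sum>\<^sub>\<infinity>k. ennreal ((knorm2 k)\<^sup>2 * cnorm2 (u k)))"

definition stokesA :: "field \<Rightarrow> field" where
  "stokesA u = (\<lambda>k. knorm2 k *\<^sub>R u k)"

definition PN :: "real \<Rightarrow> field \<Rightarrow> field" where
  "PN N u = (\<lambda>k. if k \<noteq> (0,0) \<and> sqrt (knorm2 k) \<le> N then u k else (0,0))"

text \<open>Leray projection, Fourier multiplier  I - k k^T / |k|^2 (and killing the mean)\<close>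
definition leray :: "field \<Rightarrow> field" where
  "leray w = (\<lambda>k. if k = (0,0) then (0,0)
      else (fst (w k) - kdot k (w k) / of_real (knorm2 k) * of_int (fst k),
            snd (w k) - kdot k (w k) / of_real (knorm2 k) * of_int (snd k)))"

text \<open>Fourier coefficients of (u . grad) v: sum over p + q = k of (u p . i q) v q\<close>
definition convect :: "field \<Rightarrow> field \<Rightarrow> field" where
  "convect u v = (\<lambda>k.
     ((\<Sum>\<^sub>\<infinity>p. \<i> * kdot (k - p) (u p) * fst (v (k - p))),
      (\<Sum>\<^sub>\<infinity>p. \<i> * kdot (k - p) (u p) * snd (v (k - p)))))"

definition Bop :: "field \<Rightarrow> field \<Rightarrow> field" where
  "Bop u v = leray (convect u v)"

text \<open>
  Global strong solution of  du/dt + nu A u + B(u,u) = g(t),  u(0) = u0: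
  u in C([0,T];V) and L^2(0,T;D(A)) for every T, and the equation holds
  (coefficientwise, in integrated form) on [0,infinity).
\<close>
definition strong_sol :: "real \<Rightarrow> (real \<Rightarrow> field) \<Rightarrow> (real \<Rightarrow> field) \<Rightarrow> field \<Rightarrow> bool" where
  "strong_sol \<nu> g u u0 \<longleftrightarrow>
     u 0 = u0
   \<and> (\<forall>t\<ge>0. in_V (u t))
   \<and> (\<forall>t\<ge>0. ((\<lambda>s. Vnorm (\<lambda>k. u s k - u t k)) \<longlongrightarrow> 0) (at t within {0..}))
   \<and> (\<forall>T\<ge>0. (\<integral>\<^sup>+ t. indicator {0..T} t * DAnorm2 (u t) \<partial>lborel) < \<infinity>)
   \<and> (\<forall>k. \<forall>t\<ge>0.
        ((\<lambda>s. g s k - (\<nu> * knorm2 k) *\<^sub>R u s k - Bop (u s) (u s) k)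
           has_integral (u t k - u 0 k)) {0..t})"

definition in_Linf :: "(real \<Rightarrow> field) \<Rightarrow> bool" where
  "in_Linf f \<longleftrightarrow> (\<forall>t\<ge>0. in_H (f t))
     \<and> (\<exists>M. \<forall>t\<ge>0. Hnorm (f t) \<le> M)
     \<and> (\<forall>k. set_borel_measurable lborel {0..} (\<lambda>t. f t k))"

definition fsup :: "(real \<Rightarrow> field) \<Rightarrow> real" where
  "fsup f = (SUP t\<in>{0..}. Hnorm (f t))"

definition synchronization_property :: "real \<Rightarrow> bool" where
  "synchronization_property \<nu> \<longleftrightarrow>
    (\<exists>\<mu>s :: real \<Rightarrow> real. \<exists>Ns :: real \<Rightarrow> real.
       mono_on {0<..} \<mu>s \<and> (\<forall>N>0. \<mu>s N > 0)
     \<and> continuous_on {0..} Ns \<and> (\<forall>s\<ge>0. Ns s > 0)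
     \<and> (\<forall>f. in_Linf f \<longrightarrow>
          (\<forall>N \<ge> Ns (fsup f). \<forall>\<mu> \<in> {\<mu>s (Ns (fsup f)) .. \<mu>s N}.
           \<forall>u0 v0 u v. in_V u0 \<longrightarrow> in_V v0 \<longrightarrow>
             strong_sol \<nu> f u u0 \<longrightarrow>
             strong_sol \<nu> (\<lambda>t k. f t k - \<mu> *\<^sub>R PN N (v t) k + \<mu> *\<^sub>R PN N (u t) k) v v0 \<longrightarrow>
             ((\<lambda>t. Hnorm (\<lambda>k. v t k - u t k)) \<longlongrightarrow> 0) at_top)))"

definition finite_determining_modes :: "real \<Rightarrow> bool" where
  "finite_determining_modes \<nu> \<longleftrightarrow>
    (\<forall>f1 f2. in_Linf f1 \<longrightarrow> in_Linf f2 \<longrightarrow>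
       (\<exists>N>0. \<forall>u01 u02 u1 u2. in_V u01 \<longrightarrow> in_V u02 \<longrightarrow>
           strong_sol \<nu> f1 u1 u01 \<longrightarrow> strong_sol \<nu> f2 u2 u02 \<longrightarrow>
           ((\<lambda>t. Hnorm (\<lambda>k. PN N (u1 t) k - PN N (u2 t) k)) \<longlongrightarrow> 0) at_top \<longrightarrow>
           ((\<lambda>t. Hnorm (\<lambda>k. f1 t k - f2 t k)) \<longlongrightarrow> 0) at_top \<longrightarrow>
           ((\<lambda>t. Hnorm (\<lambda>k. u1 t k - u2 t k)) \<longlongrightarrow> 0) at_top))"

end

theory Submission
  imports Defs
begin

text \<open>
  The determining modes property is obtained directly by the energy method of Foias and Prodi.
  The difference \<open>w = u\<^sub>1 - u\<^sub>2\<close> of two solutions satisfies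
  \<open>1/2 d/dt |w|\<^sup>2 + \<nu> ||w||\<^sup>2 = (f\<^sub>1 - f\<^sub>2, w) - b(w, u\<^sub>2, w)\<close>, because \<open>b(u\<^sub>1, w, w) = 0\<close>. Ladyzhenskaya's
  inequality bounds the trilinear term by \<open>\<nu>/2 ||w||\<^sup>2\<close> plus a multiple of \<open>(||u\<^sub>2|| + ||u\<^sub>2||\<^sup>2) |w|\<^sup>2\<close>, while
  \<open>||w||\<^sup>2 \<ge> N\<^sup>2 (|w|\<^sup>2 - |P\<^sub>N w|\<^sup>2)\<close>. The energy inequality for \<open>u\<^sub>2\<close> bounds the mean of \<open>||u\<^sub>2||\<^sup>2\<close> over long
  times by a constant that depends on \<open>f\<^sub>2\<close> and \<open>\<nu>\<close> only, so for large \<open>N\<close> the damping \<open>\<nu> N\<^sup>2\<close> wins on average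
  and Gronwall's lemma gives \<open>|w| \<rightarrow> 0\<close>. Testing with \<open>w\<close> is legitimate for fields in \<open>V\<close>: by the same
  inequality all double sums over Fourier modes converge absolutely.
\<close>

section \<open>Trilinear sums over the lattice\<close>

text \<open>\<open>N\<close> is fixed before the solutions, so it may depend on the forces and on
  \<nu> only, while the bounds on \<open>u2\<close> depend on its initial value. That value enters
  only as an additive constant in the bound for the time integral of the enstrophy, and Gronwall
  turns it into a finite factor \<open>exp L\<close>. The equation is available only for single
  Fourier coefficients and in integrated form, and \<open>infsum\<close> is 0 on families that are
  not summable. Hence the energy is handled mode by mode, the modes are summed under the time
  integral by dominated convergence, and every exchange or splitting of sums is backed by absolute
  convergence. Ladyzhenskaya's inequality is used with a free frequency scale \<open>R\<close>, as
  \<open>R * energy w + enstrophy w / R\<close>, so that choosing \<open>R\<close> is enough to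
  absorb the gradient. The restriction \<open>R \<ge> 1\<close> comes from the lattice: the origin
  alone contributes 1 to the weighted count, so a bound of order R^2 fails for small
  \<open>R\<close>. This restriction is the origin of the term linear in ||u2||.\<close>

lemma nonneg_summable_bound:
  fixes f :: "'a \<Rightarrow> real"
  assumes "\<And>x. x \<in> A \<Longrightarrow> 0 \<le> f x"
    and "\<And>F. finite F \<Longrightarrow> F \<subseteq> A \<Longrightarrow> sum f F \<le> B"
  shows "f summable_on A" "infsum f A \<le> B"
proof -
  show s: "f summable_on A"
    by (rule nonneg_bounded_partial_sums_imp_summable_on[where C=B])
       (use assms in \<open>auto intro!: eventually_finite_subsets_at_top_weakI\<close>)
  show "infsum f A \<le> B"
    using s assms(2) by (rule infsum_le_finite_sums)
qed

lemma L2_set_le_sqrt_infsum: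
  assumes "(\<lambda>x. (f x)\<^sup>2) summable_on UNIV" "finite F"
  shows "L2_set f F \<le> sqrt (\<Sum>\<^sub>\<infinity>x. (f x)\<^sup>2)"
  unfolding L2_set_def using assms by (auto intro!: finite_sum_le_infsum)

lemma infsum_Cauchy_Schwarz:
  fixes f g :: "'a \<Rightarrow> real"
  assumes "(\<lambda>x. (f x)\<^sup>2) summable_on UNIV" "(\<lambda>x. (g x)\<^sup>2) summable_on UNIV"
  shows "(\<lambda>x. \<bar>f x * g x\<bar>) summable_on UNIV"
    and "(\<Sum>\<^sub>\<infinity>x. \<bar>f x * g x\<bar>) \<le> sqrt (\<Sum>\<^sub>\<infinity>x. (f x)\<^sup>2) * sqrt (\<Sum>\<^sub>\<infinity>x. (g x)\<^sup>2)"
proof -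
  have "(\<Sum>x\<in>F. \<bar>f x * g x\<bar>) \<le> sqrt (\<Sum>\<^sub>\<infinity>x. (f x)\<^sup>2) * sqrt (\<Sum>\<^sub>\<infinity>x. (g x)\<^sup>2)" if "finite F" for F
  proof -
    have "(\<Sum>x\<in>F. \<bar>f x * g x\<bar>) \<le> L2_set f F * L2_set g F"
      using L2_set_mult_ineq[of f g F] by (simp add: abs_mult)
    also have "\<dots> \<le> sqrt (\<Sum>\<^sub>\<infinity>x. (f x)\<^sup>2) * sqrt (\<Sum>\<^sub>\<infinity>x. (g x)\<^sup>2)"
      using assms that by (intro mult_mono L2_set_le_sqrt_infsum) (auto intro: infsum_nonneg)
    finally show ?thesis .
  qed
  then show "(\<lambda>x. \<bar>f x * g x\<bar>) summable_on UNIV"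
    and "(\<Sum>\<^sub>\<infinity>x. \<bar>f x * g x\<bar>) \<le> sqrt (\<Sum>\<^sub>\<infinity>x. (f x)\<^sup>2) * sqrt (\<Sum>\<^sub>\<infinity>x. (g x)\<^sup>2)"
    using nonneg_summable_bound[of UNIV "\<lambda>x. \<bar>f x * g x\<bar>"] by auto
qed

text \<open>Domination in place of \<open>h = f + g\<close> lets this apply to norms of
  vector-valued differences, weighted or not. The finite triangle inequality for
  \<open>L2_set\<close> passes to the limit because its final bound does not depend on the finite
  set.\<close>

lemma infsum_Minkowski:
  fixes f g h :: "'a \<Rightarrow> real"
  assumes "(\<lambda>x. (f x)\<^sup>2) summable_on UNIV" "(\<lambda>x. (g x)\<^sup>2) summable_on UNIV"
    and h: "\<And>x. \<bar>h x\<bar> \<le> f x + g x"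
  shows "(\<lambda>x. (h x)\<^sup>2) summable_on UNIV"
    and "sqrt (\<Sum>\<^sub>\<infinity>x. (h x)\<^sup>2) \<le> sqrt (\<Sum>\<^sub>\<infinity>x. (f x)\<^sup>2) + sqrt (\<Sum>\<^sub>\<infinity>x. (g x)\<^sup>2)" (is "_ \<le> ?B")
proof -
  have B: "0 \<le> ?B" by (auto intro!: infsum_nonneg add_nonneg_nonneg)
  have *: "(\<Sum>x\<in>F. (h x)\<^sup>2) \<le> ?B\<^sup>2" if "finite F" for F
  proof -
    have "L2_set h F = L2_set (\<lambda>x. \<bar>h x\<bar>) F" by (simp add: L2_set_def)
    also have "\<dots> \<le> L2_set (\<lambda>x. f x + g x) F" using h by (intro L2_set_mono) auto
    also have "\<dots> \<le> L2_set f F + L2_set g F" by (rule L2_set_triangle_ineq)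
    also have "\<dots> \<le> ?B" using assms that by (intro add_mono L2_set_le_sqrt_infsum) auto
    finally have "(L2_set h F)\<^sup>2 \<le> ?B\<^sup>2" by (intro power_mono L2_set_nonneg)
    then show ?thesis by (simp add: L2_set_def sum_nonneg)
  qed
  then show "(\<lambda>x. (h x)\<^sup>2) summable_on UNIV"
    using nonneg_summable_bound(1)[of UNIV "\<lambda>x. (h x)\<^sup>2"] by auto
  have "(\<Sum>\<^sub>\<infinity>x. (h x)\<^sup>2) \<le> ?B\<^sup>2"
    using * nonneg_summable_bound(2)[of UNIV "\<lambda>x. (h x)\<^sup>2"] by auto
  then show "sqrt (\<Sum>\<^sub>\<infinity>x. (h x)\<^sup>2) \<le> ?B"
    using B by (rule real_le_lsqrt[rotated])
qed

section \<open>Weights and counting on the lattice Z^2\<close>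

lemma knorm2_nonneg: "0 \<le> knorm2 k"
  by (simp add: knorm2_def)

lemma knorm2_ge_1: "k \<noteq> (0,0) \<Longrightarrow> 1 \<le> knorm2 k"
proof -
  assume "k \<noteq> (0,0)"
  then have "0 < fst k ^ 2 + snd k ^ 2"
    by (metis prod.collapse sum_power2_gt_zero_iff)
  then have "1 \<le> fst k ^ 2 + snd k ^ 2" by linarith
  then show ?thesis unfolding knorm2_def
    by (metis of_int_1 of_int_le_iff)
qed

text \<open>For n \<ge> 1 the term is at most
  \<open>2 * R\<^sup>2 / ((R + n - 1) * (R + n))\<close>, which telescopes and replaces a comparison
  with the arctangent integral. The subtracted tail makes the induction close; afterwards only
  \<open>1 + 4 * R\<close> matters.\<close>

lemma sum_inverse_weight_le:
  fixes R :: real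
  assumes "R \<ge> 1"
  shows "(\<Sum>n = -int M..int M. 1 / (1 + (real_of_int n)\<^sup>2 / R\<^sup>2)) \<le> 1 + 4 * R - 4 * R\<^sup>2 / (R + real M)"
proof (induction M)
  case 0
  then show ?case using assms by (simp add: power2_eq_square)
next
  case (Suc M)
  let ?f = "\<lambda>n::int. 1 / (1 + (real_of_int n)\<^sup>2 / R\<^sup>2)"
  let ?n = "real M + 1"
  have set: "{-int (Suc M)..int (Suc M)} = insert (- int (Suc M)) (insert (int (Suc M)) {-int M..int M})"
    by auto
  have "sum ?f {-int (Suc M)..int (Suc M)} = 2 * (1 / (1 + ?n\<^sup>2 / R\<^sup>2)) + sum ?f {-int M..int M}"
    unfolding set by (simp add: add.commute power2_commute) (simp add: power2_eq_square algebra_simps)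
  also have "1 / (1 + ?n\<^sup>2 / R\<^sup>2) \<le> 2 * R\<^sup>2 / ((R + real M) * (R + ?n))"
  proof -
    have "(R + real M) * (R + ?n) \<le> (R + ?n)\<^sup>2"
      using assms unfolding power2_eq_square by (intro mult_right_mono) auto
    also have "\<dots> \<le> 2 * (R\<^sup>2 + ?n\<^sup>2)"
      using sum_squares_bound[of R ?n] by (simp add: power2_eq_square algebra_simps)
    finally have 1: "(R + real M) * (R + ?n) \<le> 2 * (R\<^sup>2 + ?n\<^sup>2)" .
    have pos: "0 < (R + real M) * (R + ?n)" using assms by auto
    have p2: "0 < R\<^sup>2 + ?n\<^sup>2" by (simp add: add_pos_nonneg sum_power2_gt_zero_iff)
    have "1 / (1 + ?n\<^sup>2 / R\<^sup>2) = R\<^sup>2 / (R\<^sup>2 + ?n\<^sup>2)" using assms p2 by (simp add: field_simps)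
    also have "\<dots> \<le> 2 * R\<^sup>2 / ((R + real M) * (R + ?n))"
    proof -
      have "R\<^sup>2 * ((R + real M) * (R + ?n)) \<le> R\<^sup>2 * (2 * (R\<^sup>2 + ?n\<^sup>2))"
        using 1 by (rule mult_left_mono) simp
      then show ?thesis using pos p2 by (simp add: divide_le_eq pos_le_divide_eq algebra_simps)
    qed
    finally show ?thesis .
  qed
  also have "2 * R\<^sup>2 / ((R + real M) * (R + ?n)) = 2 * (R\<^sup>2 / (R + real M) - R\<^sup>2 / (R + ?n))"
    using assms by (simp add: field_simps)
  also note Suc.IH
  finally show ?case by (simp add: algebra_simps)
qed

text \<open>The plane weight is bounded by a product of two one-dimensional weights, since (1 + x)
  (1 + y) \<le> (1 + x + y)^2 for x, y \<ge> 0. The square on the weight is essential: its first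
  power is not summable over Z^2.\<close>

lemma lattice_weight_sum_le:
  fixes R :: real
  assumes "R \<ge> 1" "finite F"
  shows "(\<Sum>p\<in>F. (1 / (1 + knorm2 p / R\<^sup>2))\<^sup>2) \<le> (5 * R)\<^sup>2"
proof -
  define g where "g n = 1 / (1 + (real_of_int n)\<^sup>2 / R\<^sup>2)" for n
  have g0: "0 \<le> g n" for n by (simp add: g_def)
  define M where "M = nat (\<Sum>p\<in>F. \<bar>fst p\<bar> + \<bar>snd p\<bar>)"
  let ?I = "{-int M..int M}"
  have "F \<subseteq> ?I \<times> ?I"
  proof
    fix p assume "p \<in> F"
    then have "\<bar>fst p\<bar> + \<bar>snd p\<bar> \<le> (\<Sum>p\<in>F. \<bar>fst p\<bar> + \<bar>snd p\<bar>)"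
      using assms(2) by (intro member_le_sum) auto
    then have "\<bar>fst p\<bar> + \<bar>snd p\<bar> \<le> int M" unfolding M_def by linarith
    then have "fst p \<in> ?I" "snd p \<in> ?I" by auto
    then show "p \<in> ?I \<times> ?I" by (simp add: mem_Times_iff)
  qed
  have pt: "(1 / (1 + knorm2 p / R\<^sup>2))\<^sup>2 \<le> g (fst p) * g (snd p)" for p
  proof -
    let ?x = "(real_of_int (fst p))\<^sup>2 / R\<^sup>2" and ?y = "(real_of_int (snd p))\<^sup>2 / R\<^sup>2"
    have xy: "0 \<le> ?x" "0 \<le> ?y" by auto
    have e: "1 + knorm2 p / R\<^sup>2 = 1 + (?x + ?y)" by (simp add: knorm2_def add_divide_distrib)
    have "(1 + ?x) * (1 + ?y) \<le> (1 + (?x + ?y)) * (1 + (?x + ?y))"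
      using xy by (intro mult_mono) auto
    then have "1 / ((1 + (?x + ?y)) * (1 + (?x + ?y))) \<le> 1 / ((1 + ?x) * (1 + ?y))"
      using xy by (intro divide_left_mono mult_pos_pos) (auto simp: add_pos_nonneg)
    then show ?thesis unfolding e g_def by (simp add: power2_eq_square)
  qed
  have "(\<Sum>p\<in>F. (1 / (1 + knorm2 p / R\<^sup>2))\<^sup>2) \<le> (\<Sum>p\<in>F. g (fst p) * g (snd p))"
    by (rule sum_mono) (rule pt)
  also have "\<dots> \<le> (\<Sum>p\<in>?I \<times> ?I. g (fst p) * g (snd p))"
    using \<open>F \<subseteq> _\<close> g0 by (intro sum_mono2) auto
  also have "\<dots> = (\<Sum>n\<in>?I. g n)\<^sup>2"
    unfolding power2_eq_square sum_product sum.cartesian_product by (simp add: case_prod_beta)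
  also have "\<dots> \<le> (5 * R)\<^sup>2"
  proof (intro power_mono sum_nonneg g0)
    have "0 \<le> 4 * R\<^sup>2 / (R + real M)" using assms by simp
    then show "sum g ?I \<le> 5 * R"
      using sum_inverse_weight_le[OF assms(1), of M] assms(1) unfolding g_def by linarith
  qed
  finally show ?thesis .
qed

section \<open>The discrete Ladyzhenskaya inequality\<close>

locale trilinear =
  fixes m b :: "int \<times> int \<Rightarrow> real"
  assumes m_nonneg: "\<And>p. 0 \<le> m p" and b_nonneg: "\<And>p. 0 \<le> b p"
    and m_summable: "(\<lambda>p. (m p)\<^sup>2) summable_on UNIV"
    and km_summable: "(\<lambda>p. knorm2 p * (m p)\<^sup>2) summable_on UNIV"
    and b_summable: "(\<lambda>p. (b p)\<^sup>2) summable_on UNIV"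
begin

text \<open>In the applications \<open>m\<close> bounds the mode sizes of the two outer factors and
  \<open>b\<close> holds those of the gradient in the middle. \<open>mass R\<close> is the squared
  l^2 norm of \<open>m\<close> with weight \<open>1 + knorm2 p / R\<^sup>2\<close>; \<open>R\<close>
  marks the frequency beyond which the gradient part of the weight dominates.\<close>

definition "mass R = (\<Sum>\<^sub>\<infinity>p. (m p)\<^sup>2) + (\<Sum>\<^sub>\<infinity>p. knorm2 p * (m p)\<^sup>2) / R\<^sup>2"

lemma mass_nonneg: "0 \<le> mass R"
  unfolding mass_def by (intro add_nonneg_nonneg divide_nonneg_nonneg infsum_nonneg mult_nonneg_nonneg knorm2_nonneg) auto

lemma weighted_sum_le:
  assumes "finite F"
  shows "(\<Sum>p\<in>F. (1 + knorm2 p / R\<^sup>2) * (m p)\<^sup>2) \<le> mass R"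
proof -
  have "(\<Sum>p\<in>F. (1 + knorm2 p / R\<^sup>2) * (m p)\<^sup>2) = (\<Sum>p\<in>F. (m p)\<^sup>2) + (\<Sum>p\<in>F. knorm2 p * (m p)\<^sup>2) / R\<^sup>2"
    by (simp add: algebra_simps sum.distrib sum_divide_distrib)
  also have "\<dots> \<le> mass R" unfolding mass_def using assms m_summable km_summable
    by (intro add_mono divide_right_mono finite_sum_le_infsum) (auto simp: knorm2_nonneg)
  finally show ?thesis .
qed

text \<open>Chebyshev's argument: on \<open>K\<close> the weight at \<open>k\<close> is at least the
  weight at \<open>p\<close>, so the l^2 mass of \<open>m\<close> on \<open>K\<close> gains the
  factor \<open>1 / (1 + knorm2 p / R\<^sup>2)\<close>. The shifted \<open>b\<close> is simply
  bounded by its full l^2 norm.\<close>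

lemma inner_sum_le:
  assumes "finite K" "R \<ge> 1" "\<And>k. k \<in> K \<Longrightarrow> knorm2 p \<le> knorm2 k"
  shows "(\<Sum>k\<in>K. m k * b (k - p)) \<le> sqrt (mass R / (1 + knorm2 p / R\<^sup>2)) * sqrt (\<Sum>\<^sub>\<infinity>p. (b p)\<^sup>2)"
proof -
  have w: "0 < 1 + knorm2 p / R\<^sup>2" by (intro add_pos_nonneg) (auto simp: knorm2_nonneg)
  have "(\<Sum>k\<in>K. m k * b (k - p)) \<le> L2_set m K * L2_set (\<lambda>k. b (k - p)) K"
    using L2_set_mult_ineq[of m "\<lambda>k. b (k - p)" K] m_nonneg b_nonneg by simp
  also have "\<dots> \<le> sqrt (mass R / (1 + knorm2 p / R\<^sup>2)) * sqrt (\<Sum>\<^sub>\<infinity>p. (b p)\<^sup>2)"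
  proof (intro mult_mono L2_set_nonneg)
    have "(1 + knorm2 p / R\<^sup>2) * (\<Sum>k\<in>K. (m k)\<^sup>2) \<le> (\<Sum>k\<in>K. (1 + knorm2 k / R\<^sup>2) * (m k)\<^sup>2)"
      unfolding sum_distrib_left using assms(3)
      by (intro sum_mono mult_right_mono add_left_mono divide_right_mono) auto
    also have "\<dots> \<le> mass R" by (rule weighted_sum_le[OF assms(1)])
    finally show "L2_set m K \<le> sqrt (mass R / (1 + knorm2 p / R\<^sup>2))"
      unfolding L2_set_def using w by (simp add: pos_le_divide_eq mult.commute)
    have "(\<Sum>k\<in>K. (b (k - p))\<^sup>2) = (\<Sum>k\<in>(\<lambda>k. k - p) ` K. (b k)\<^sup>2)"
      by (subst sum.reindex) (auto simp: inj_on_def)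
    also have "\<dots> \<le> (\<Sum>\<^sub>\<infinity>p. (b p)\<^sup>2)"
      using assms b_summable by (intro finite_sum_le_infsum) auto
    finally show "L2_set (\<lambda>k. b (k - p)) K \<le> sqrt (\<Sum>\<^sub>\<infinity>p. (b p)\<^sup>2)"
      unfolding L2_set_def by simp
  qed (use mass_nonneg w in auto)
  finally show ?thesis .
qed

text \<open>For \<open>|p| \<le> |k|\<close> the factor \<open>m k\<close> sits in the tail beyond \<open>|p|\<close>, whose mass is at most
  \<open>mass R / (1 + |p|\<^sup>2/R\<^sup>2)\<close>; this decay makes the remaining sum over \<open>p\<close> converge without losing
  the scaling of the Ladyzhenskaya inequality.\<close>
lemma half_sum_le:
  assumes "finite F" "R \<ge> 1" "\<And>p k. (p,k) \<in> F \<Longrightarrow> knorm2 p \<le> knorm2 k"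
  shows "(\<Sum>(p,k)\<in>F. m p * m k * b (k - p)) \<le> 5 * R * mass R * sqrt (\<Sum>\<^sub>\<infinity>p. (b p)\<^sup>2)"
proof -
  let ?w = "\<lambda>p. 1 + knorm2 p / R\<^sup>2" and ?nb = "sqrt (\<Sum>\<^sub>\<infinity>p. (b p)\<^sup>2)"
  have w: "0 < ?w p" for p by (intro add_pos_nonneg) (auto simp: knorm2_nonneg)
  have nb: "0 \<le> ?nb" by (simp add: infsum_nonneg)
  let ?K = "\<lambda>p. {k \<in> snd ` F. knorm2 p \<le> knorm2 k}"
  \<comment> \<open>Enlarging \<open>F\<close> to all admissible pairs from its projections makes
    the sum iterated, so that the inner sum over \<open>k\<close> can be estimated for fixed
    \<open>p\<close>.\<close>
  have "(\<Sum>(p,k)\<in>F. m p * m k * b (k - p)) \<le> (\<Sum>(p,k)\<in>Sigma (fst ` F) ?K. m p * m k * b (k - p))"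
    using assms m_nonneg b_nonneg
    by (intro sum_mono2) (auto simp: image_iff intro!: finite_SigmaI, (metis fst_conv snd_conv)+)
  also have "\<dots> = (\<Sum>p\<in>fst ` F. m p * (\<Sum>k\<in>?K p. m k * b (k - p)))"
    using assms by (subst sum.Sigma[symmetric]) (auto simp: sum_distrib_left mult.assoc)
  also have "\<dots> \<le> (\<Sum>p\<in>fst ` F. m p * (sqrt (mass R / ?w p) * ?nb))"
    using assms m_nonneg by (intro sum_mono mult_left_mono inner_sum_le) auto
  \<comment> \<open>With w the weight, 1 / sqrt w is written as sqrt w / w: a second Cauchy-Schwarz
    then meets the full weighted mass of \<open>m\<close> and the weight 1 / w, whose l^2 norm on
    Z^2 is at most \<open>5 * R\<close>.\<close>
  also have "\<dots> = sqrt (mass R) * ?nb * (\<Sum>p\<in>fst ` F. \<bar>sqrt (?w p) * m p\<bar> * \<bar>1 / ?w p\<bar>)"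
  proof -
    have "m p * (sqrt (mass R / ?w p) * ?nb) = sqrt (mass R) * ?nb * (\<bar>sqrt (?w p) * m p\<bar> * \<bar>1 / ?w p\<bar>)" for p
    proof -
      have "\<bar>sqrt (?w p) * m p\<bar> * \<bar>1 / ?w p\<bar> = m p * (sqrt (?w p) / ?w p)"
        using w[of p] m_nonneg[of p] by (simp add: abs_mult)
      also have "sqrt (?w p) / ?w p = 1 / sqrt (?w p)"
        using w[of p] by (simp add: real_div_sqrt field_simps)
      finally show ?thesis by (simp add: real_sqrt_divide)
    qed
    then show ?thesis by (simp add: sum_distrib_left)
  qed
  also have "\<dots> \<le> sqrt (mass R) * ?nb * (L2_set (\<lambda>p. sqrt (?w p) * m p) (fst ` F) * L2_set (\<lambda>p. 1 / ?w p) (fst ` F))"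
    using mass_nonneg nb by (intro mult_left_mono L2_set_mult_ineq mult_nonneg_nonneg) auto
  also have "\<dots> \<le> sqrt (mass R) * ?nb * (sqrt (mass R) * (5 * R))"
  proof (intro mult_left_mono mult_mono L2_set_nonneg)
    have "(sqrt (?w p) * m p)\<^sup>2 = ?w p * (m p)\<^sup>2" for p
      using w[of p] by (simp add: power_mult_distrib)
    then show "L2_set (\<lambda>p. sqrt (?w p) * m p) (fst ` F) \<le> sqrt (mass R)"
      unfolding L2_set_def using weighted_sum_le[of "fst ` F" R] assms(1) by simp
    have "(\<Sum>p\<in>fst ` F. (1 / ?w p)\<^sup>2) \<le> (5 * R)\<^sup>2"
      using assms by (intro lattice_weight_sum_le) auto
    then show "L2_set (\<lambda>p. 1 / ?w p) (fst ` F) \<le> 5 * R"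
      unfolding L2_set_def using assms(2) by (intro real_le_lsqrt) auto
  qed (use mass_nonneg nb in auto)
  also have "\<dots> = 5 * R * mass R * ?nb"
  proof -
    have "sqrt (mass R) * sqrt (mass R) = mass R" using mass_nonneg by simp
    then show ?thesis by (metis (no_types, lifting) mult.assoc mult.commute)
  qed
  finally show ?thesis .
qed

end

text \<open>Exchanging \<open>p\<close> and \<open>k\<close> in \<open>m p * m k * b (k - p)\<close>
  reverses the argument of \<open>b\<close>. The pairs with |p| > |k| thus fall under the half-sum
  estimate for the reflected sequence.\<close>

lemma (in trilinear) trilinear_reflect: "trilinear m (\<lambda>q. b (- q))"
proof
  have "bij (uminus :: int \<times> int \<Rightarrow> _)" by (rule bij_uminus)
  then show "(\<lambda>p. (b (- p))\<^sup>2) summable_on UNIV"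
    using summable_on_reindex_bij_betw[of uminus UNIV UNIV "\<lambda>p. (b p)\<^sup>2"] b_summable by auto
qed (use m_nonneg b_nonneg m_summable km_summable in auto)

lemma infsum_reflect: "(\<Sum>\<^sub>\<infinity>p. f (- p)) = (\<Sum>\<^sub>\<infinity>p :: int \<times> int. f p)"
  using infsum_reindex_bij_betw[OF bij_uminus] .

context trilinear
begin

text \<open>Ladyzhenskaya's inequality in Fourier variables: optimising over \<open>R\<close> gives a multiple of
  \<open>|b| |m| ||m||\<close>.\<close>
lemma trilinear_sum:
  assumes "R \<ge> 1"
  shows "(\<lambda>(p,k). m p * m k * b (k - p)) summable_on UNIV"
    and "(\<Sum>\<^sub>\<infinity>(p,k). m p * m k * b (k - p)) \<le>
      10 * sqrt (\<Sum>\<^sub>\<infinity>p. (b p)\<^sup>2) * (R * (\<Sum>\<^sub>\<infinity>p. (m p)\<^sup>2) + (\<Sum>\<^sub>\<infinity>p. knorm2 p * (m p)\<^sup>2) / R)"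
proof -
  let ?G = "\<lambda>(p,k). m p * m k * b (k - p)" and ?nb = "sqrt (\<Sum>\<^sub>\<infinity>p. (b p)\<^sup>2)"
  interpret r: trilinear m "\<lambda>q. b (- q)" by (rule trilinear_reflect)
  have *: "sum ?G F \<le> 10 * R * mass R * ?nb" if F: "finite F" for F
  proof -
    let ?A = "{x \<in> F. knorm2 (fst x) \<le> knorm2 (snd x)}"
    let ?B = "F - ?A"
    have "sum ?G ?A \<le> 5 * R * mass R * ?nb"
      using F assms by (intro half_sum_le) auto
    moreover have "sum ?G ?B \<le> 5 * R * mass R * ?nb"
    proof -
      have "sum ?G ?B = (\<Sum>(p,k)\<in>prod.swap ` ?B. m p * m k * b (- (k - p)))"
        by (subst sum.reindex) (auto simp: case_prod_beta mult_ac)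
      also have "\<dots> \<le> 5 * R * r.mass R * sqrt (\<Sum>\<^sub>\<infinity>p. (b (- p))\<^sup>2)"
        using F assms by (intro r.half_sum_le) auto
      also have "\<dots> = 5 * R * mass R * ?nb"
        using infsum_reflect[of "\<lambda>p. (b p)\<^sup>2"] by (simp add: mass_def r.mass_def)
      finally show ?thesis .
    qed
    moreover have "sum ?G F = sum ?G ?A + sum ?G ?B"
      using F by (subst sum.subset_diff[of ?A F]) auto
    ultimately show ?thesis by simp
  qed
  have nn: "0 \<le> ?G x" for x using m_nonneg b_nonneg by (auto split: prod.split)
  show "?G summable_on UNIV"
    using nonneg_summable_bound(1)[of UNIV ?G] nn * by blast
  have "infsum ?G UNIV \<le> 10 * R * mass R * ?nb"
    using nonneg_summable_bound(2)[of UNIV ?G] nn * by blast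
  also have "\<dots> = 10 * ?nb * (R * (\<Sum>\<^sub>\<infinity>p. (m p)\<^sup>2) + (\<Sum>\<^sub>\<infinity>p. knorm2 p * (m p)\<^sup>2) / R)"
    using assms by (simp add: mass_def field_simps power2_eq_square)
  finally show "infsum ?G UNIV \<le> 10 * ?nb * (R * (\<Sum>\<^sub>\<infinity>p. (m p)\<^sup>2) + (\<Sum>\<^sub>\<infinity>p. knorm2 p * (m p)\<^sup>2) / R)" .
qed

end

section \<open>Indefinite integrals and Gronwall's lemma\<close>

text \<open>Difference quotients are at most \<open>C * \<bar>t - s\<bar>\<close>, so the derivative
  is zero everywhere. This yields identities between functions whose ingredients are not known to be
  differentiable.\<close>

lemma constant_if_quadratic_increments:
  fixes f :: "real \<Rightarrow> 'a::real_normed_vector"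
  assumes "a \<le> b"
    and inc: "\<And>s t. a \<le> s \<Longrightarrow> s \<le> t \<Longrightarrow> t \<le> b \<Longrightarrow> norm (f t - f s) \<le> C * (t - s)\<^sup>2"
  shows "f b = f a"
proof -
  have inc': "norm (f t - f s) \<le> C * (t - s)\<^sup>2" if "s \<in> {a..b}" "t \<in> {a..b}" for s t
    using inc[of s t] inc[of t s] that
    by (cases "s \<le> t") (auto simp: norm_minus_commute power2_commute)
  have "(f has_derivative (\<lambda>h. 0)) (at x within {a..b})" if x: "x \<in> {a..b}" for x
    unfolding has_derivative_within
  proof (rule conjI[OF bounded_linear_zero], rule Lim_null_comparison[where g="\<lambda>y. C * \<bar>y - x\<bar>"])
    have "((\<lambda>y. C * \<bar>y - x\<bar>) \<longlongrightarrow> C * \<bar>x - x\<bar>) (at x within {a..b})"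
      by (intro tendsto_intros)
    then show "((\<lambda>y. C * \<bar>y - x\<bar>) \<longlongrightarrow> 0) (at x within {a..b})" by simp
    show "\<forall>\<^sub>F y in at x within {a..b}. norm ((1 / norm (y - x)) *\<^sub>R (f y - (f x + 0))) \<le> C * \<bar>y - x\<bar>"
      unfolding eventually_at_filter
    proof (intro always_eventually allI impI)
      fix y assume y: "y \<noteq> x" "y \<in> {a..b}"
      have "norm (f y - f x) \<le> C * (\<bar>y - x\<bar> * \<bar>y - x\<bar>)"
        using inc'[OF x y(2)] by (simp add: power2_eq_square)
      then show "norm ((1 / norm (y - x)) *\<^sub>R (f y - (f x + 0))) \<le> C * \<bar>y - x\<bar>"
        using y by (simp add: divide_le_eq mult.assoc)
    qed
  qed
  then show ?thesis
    using has_derivative_zero_unique[of "{a..b}" f b a] assms(1) by auto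
qed

lemma has_integral_increment:
  fixes x :: "real \<Rightarrow> 'a::euclidean_space"
  assumes "\<And>t. t \<in> {a..b} \<Longrightarrow> (\<xi> has_integral (x t - x a)) {a..t}"
    and "a \<le> s" "s \<le> t" "t \<le> b"
  shows "(\<xi> has_integral (x t - x s)) {s..t}"
proof -
  have i: "\<xi> integrable_on {a..t}" and it: "integral {a..t} \<xi> = x t - x a"
    and i_s: "integral {a..s} \<xi> = x s - x a"
    using assms(1)[of t] assms(1)[of s] assms(2-) by (auto intro: integral_unique)
  have "integral {s..t} \<xi> = x t - x s"
    using Henstock_Kurzweil_Integration.integral_combine[of a s t \<xi>] assms i it i_s
    by (simp add: algebra_simps)
  moreover have "\<xi> integrable_on {s..t}"
    using i assms by (auto intro: integrable_on_subinterval)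
  ultimately show ?thesis using integrable_integral by fastforce
qed

lemma has_integral_lipschitz:
  fixes z :: "real \<Rightarrow> 'a::euclidean_space"
  assumes z: "\<And>t. t \<in> {a..b} \<Longrightarrow> (\<theta> has_integral (z t - z a)) {a..t}"
    and M: "\<And>t. t \<in> {a..b} \<Longrightarrow> norm (\<theta> t) \<le> M" "0 \<le> M" and st: "a \<le> s" "s \<le> t" "t \<le> b"
  shows "norm (z t - z s) \<le> M * (t - s)"
proof -
  have "norm (z t - z s) \<le> M * measure lborel {s..t}"
    by (rule has_integral_bound_real[where S="{}", OF M(2) _ has_integral_increment[OF z st]])
       (use M(1) st in auto)
  then show ?thesis using st by simp
qed

lemma has_integral_imp_continuous_on:
  fixes z :: "real \<Rightarrow> 'a::euclidean_space"
  assumes z: "\<And>t. t \<in> {a..b} \<Longrightarrow> (\<theta> has_integral (z t - z a)) {a..t}" and ab: "a \<le> b"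
  shows "continuous_on {a..b} z"
proof -
  have "continuous_on {a..b} (\<lambda>t. z a + integral {a..t} \<theta>)"
    using z[of b] ab by (intro continuous_intros indefinite_integral_continuous_1) auto
  moreover have "z a + integral {a..t} \<theta> = z t" if "t \<in> {a..b}" for t
    using integral_unique[OF z[OF that]] by simp
  ultimately show ?thesis by (rule continuous_on_eq)
qed

lemma has_integral_bounded_imp_absolutely_integrable:
  fixes \<theta> :: "real \<Rightarrow> 'a::euclidean_space"
  assumes "(\<theta> has_integral I) {a..b}" and "\<And>t. t \<in> {a..b} \<Longrightarrow> norm (\<theta> t) \<le> M"
  shows "\<theta> absolutely_integrable_on {a..b}"
  by (rule absolutely_integrable_integrable_bound[where g="\<lambda>_. M"]) (use assms in auto)

lemma continuous_on_bounded_measurable: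
  fixes z :: "real \<Rightarrow> 'a::euclidean_space"
  assumes "continuous_on {a..b} z"
  shows "z \<in> borel_measurable (lebesgue_on {a..b})" "bounded (z ` {a..b})"
proof -
  show "z \<in> borel_measurable (lebesgue_on {a..b})"
    using assms by (rule continuous_imp_measurable_on_sets_lebesgue) simp
  show "bounded (z ` {a..b})"
    by (intro compact_imp_bounded compact_continuous_image assms compact_Icc)
qed

text \<open>The equation only holds in integrated form with bounded integrands, so the difference of the two
  sides of the product rule is shown to have increments of order \<open>(t - s)\<^sup>2\<close>.\<close>
lemma has_integral_bilinear_product:
  fixes h :: "'a::euclidean_space \<Rightarrow> 'b::euclidean_space \<Rightarrow> 'c::euclidean_space"
    and a b :: real
  assumes h: "bounded_bilinear h" and ab: "a \<le> b"
    and x: "\<And>t. t \<in> {a..b} \<Longrightarrow> (\<xi> has_integral (x t - x a)) {a..t}"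
    and y: "\<And>t. t \<in> {a..b} \<Longrightarrow> (\<zeta> has_integral (y t - y a)) {a..t}"
    and C: "\<And>t. t \<in> {a..b} \<Longrightarrow> norm (\<xi> t) \<le> C"
    and D: "\<And>t. t \<in> {a..b} \<Longrightarrow> norm (\<zeta> t) \<le> D"
  shows "((\<lambda>t. h (\<xi> t) (y t) + h (x t) (\<zeta> t)) has_integral (h (x b) (y b) - h (x a) (y a))) {a..b}"
proof -
  interpret h: bounded_bilinear h by (rule h)
  obtain K where K: "\<And>u v. norm (h u v) \<le> norm u * norm v * K" and K0: "K \<ge> 0"
    using h.nonneg_bounded by blast
  have "a \<in> {a..b}" using ab by simp
  then have C0: "0 \<le> C" and D0: "0 \<le> D"
    using order_trans[OF norm_ge_zero C] order_trans[OF norm_ge_zero D] by blast+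
  have absx: "\<xi> absolutely_integrable_on {a..b}"
    using x[of b] C ab by (intro has_integral_bounded_imp_absolutely_integrable) auto
  have absy: "\<zeta> absolutely_integrable_on {a..b}"
    using y[of b] D ab by (intro has_integral_bounded_imp_absolutely_integrable) auto
  have bil: "bilinear h" using h by (simp add: bilinear_conv_bounded_bilinear)
  have bil': "bilinear (\<lambda>v u. h u v)"
    using h.flip by (simp add: bilinear_conv_bounded_bilinear)
  have "(\<lambda>t. h (x t) (\<zeta> t)) absolutely_integrable_on {a..b}"
    using continuous_on_bounded_measurable[OF has_integral_imp_continuous_on[OF x ab]] absy
    by (intro absolutely_integrable_bounded_measurable_product[OF bil]) auto
  moreover have "(\<lambda>t. h (\<xi> t) (y t)) absolutely_integrable_on {a..b}"
    using continuous_on_bounded_measurable[OF has_integral_imp_continuous_on[OF y ab]] absx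
    by (intro absolutely_integrable_bounded_measurable_product[OF bil']) auto
  ultimately have int: "(\<lambda>t. h (\<xi> t) (y t) + h (x t) (\<zeta> t)) integrable_on {a..b}"
    by (intro integrable_add) (auto dest: absolutely_integrable_on_def[THEN iffD1])
  let ?I = "\<lambda>t. h (\<xi> t) (y t) + h (x t) (\<zeta> t)"
  define E where "E t = h (x t) (y t) - integral {a..t} ?I" for t
  \<comment> \<open>With dx and dy the increments of \<open>x\<close> and \<open>y\<close>, h(x t, y
    t) - h(x s, y s) = h(dx, y s) + h(x s, dy) + h(dx, dy). Freezing \<open>y\<close> and
    \<open>x\<close> at time \<open>s\<close> under the integral costs one \<open>C * D * K\<close>
    each, and the last term costs the third.\<close>
  have "norm (E t - E s) \<le> (3 * (C * D * K)) * (t - s)\<^sup>2" if st: "a \<le> s" "s \<le> t" "t \<le> b" for s t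
  proof -
    have i: "integral {a..t} ?I = integral {a..s} ?I + integral {s..t} ?I"
      using st int by (intro Henstock_Kurzweil_Integration.integral_combine[symmetric])
        (auto intro: integrable_on_subinterval)
    have hI: "(?I has_integral integral {s..t} ?I) {s..t}"
      using st int by (intro integrable_integral) (auto intro: integrable_on_subinterval)
    have "((\<lambda>r. h (\<xi> r) (y s)) has_integral h (x t - x s) (y s)) {s..t}"
      using has_integral_linear[OF has_integral_increment[OF x st] h.bounded_linear_left[of "y s"]]
      by (simp add: o_def)
    moreover have "((\<lambda>r. h (x s) (\<zeta> r)) has_integral h (x s) (y t - y s)) {s..t}"
      using has_integral_linear[OF has_integral_increment[OF y st] h.bounded_linear_right[of "x s"]]
      by (simp add: o_def)
    ultimately have "((\<lambda>r. (h (\<xi> r) (y s) + h (x s) (\<zeta> r)) - ?I r) has_integral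
        (h (x t - x s) (y s) + h (x s) (y t - y s)) - integral {s..t} ?I) {s..t}"
      using hI by (intro has_integral_diff has_integral_add)
    then have "norm ((h (x t - x s) (y s) + h (x s) (y t - y s)) - integral {s..t} ?I)
        \<le> (2 * (C * D * K) * (t - s)) * measure lborel {s..t}"
    proof (rule has_integral_bound_real[where S="{}", rotated -2])
      fix r assume r: "r \<in> {s..t} - {}"
      have "norm (h (\<xi> r) (y s - y r)) \<le> norm (\<xi> r) * norm (y s - y r) * K" by (rule K)
      also have "\<dots> \<le> C * (D * (t - s)) * K"
      proof (intro mult_right_mono mult_mono K0)
        have "norm (y r - y s) \<le> D * (r - s)" using r st by (intro has_integral_lipschitz[OF y D D0]) auto
        also have "\<dots> \<le> D * (t - s)" using r D0 by (intro mult_left_mono) auto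
        finally show "norm (y s - y r) \<le> D * (t - s)" by (simp add: norm_minus_commute)
      qed (use C r st C0 in auto)
      finally have 1: "norm (h (\<xi> r) (y s - y r)) \<le> C * (D * (t - s)) * K" .
      have "norm (h (x s - x r) (\<zeta> r)) \<le> norm (x s - x r) * norm (\<zeta> r) * K" by (rule K)
      also have "\<dots> \<le> C * (t - s) * D * K"
      proof (intro mult_right_mono mult_mono K0)
        have "norm (x r - x s) \<le> C * (r - s)" using r st by (intro has_integral_lipschitz[OF x C C0]) auto
        also have "\<dots> \<le> C * (t - s)" using r C0 by (intro mult_left_mono) auto
        finally show "norm (x s - x r) \<le> C * (t - s)" by (simp add: norm_minus_commute)
      qed (use D r st C0 in auto)
      finally have 2: "norm (h (x s - x r) (\<zeta> r)) \<le> C * (t - s) * D * K" .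
      have "(h (\<xi> r) (y s) + h (x s) (\<zeta> r)) - ?I r = h (\<xi> r) (y s - y r) + h (x s - x r) (\<zeta> r)"
        by (simp add: h.diff_left h.diff_right)
      also have "norm \<dots> \<le> 2 * (C * D * K) * (t - s)"
        using norm_triangle_mono[OF 1 2] by (simp add: algebra_simps)
      finally show "norm ((h (\<xi> r) (y s) + h (x s) (\<zeta> r)) - ?I r) \<le> 2 * (C * D * K) * (t - s)" .
    qed (use C0 D0 K0 st in auto)
    then have A: "norm ((h (x t - x s) (y s) + h (x s) (y t - y s)) - integral {s..t} ?I)
        \<le> 2 * (C * D * K) * (t - s)\<^sup>2"
      using st by (simp add: power2_eq_square mult.assoc)
    have "norm (h (x t - x s) (y t - y s)) \<le> norm (x t - x s) * norm (y t - y s) * K" by (rule K)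
    also have "\<dots> \<le> (C * (t - s)) * (D * (t - s)) * K"
      using has_integral_lipschitz[OF x C C0 st] has_integral_lipschitz[OF y D D0 st] st C0 by (intro mult_right_mono mult_mono K0) auto
    finally have B: "norm (h (x t - x s) (y t - y s)) \<le> C * D * K * (t - s)\<^sup>2"
      by (simp add: power2_eq_square mult_ac)
    have "norm (h (x t - x s) (y t - y s)
        + ((h (x t - x s) (y s) + h (x s) (y t - y s)) - integral {s..t} ?I))
        \<le> (3 * (C * D * K)) * (t - s)\<^sup>2"
      using norm_triangle_mono[OF B A] by (simp add: algebra_simps)
    moreover have "E t - E s = h (x t - x s) (y t - y s)
        + ((h (x t - x s) (y s) + h (x s) (y t - y s)) - integral {s..t} ?I)"
      unfolding E_def i by (simp add: h.diff_left h.diff_right)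
    ultimately show ?thesis by metis
  qed
  then have "E b = E a" by (rule constant_if_quadratic_increments[OF ab])
  then have "integral {a..b} ?I = h (x b) (y b) - h (x a) (y a)"
    by (simp add: E_def algebra_simps)
  then show ?thesis using int integrable_integral by fastforce
qed

text \<open>\<open>a\<close> may be negative for a while: only its integrals are bounded below, and
  the deficit \<open>L\<close> reappears as the factor \<open>exp L\<close>. As \<open>y\<close> is
  merely an indefinite integral of a bounded function, the integrating factor \<open>e\<close> is
  applied through the bilinear product rule.\<close>

lemma gronwall_bound:
  fixes y \<Phi> a :: "real \<Rightarrow> real"
  assumes y: "\<And>s t. 0 \<le> s \<Longrightarrow> s \<le> t \<Longrightarrow> (\<Phi> has_integral (y t - y s)) {s..t}"
    and bdd: "\<And>T. \<exists>C. \<forall>r\<in>{0..T}. \<bar>\<Phi> r\<bar> \<le> C"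
    and a: "continuous_on {0..} a"
    and lower: "\<And>s t. 0 \<le> s \<Longrightarrow> s \<le> t \<Longrightarrow> \<delta> * (t - s) - L \<le> integral {s..t} a"
    and "0 < \<delta>" "0 \<le> B" "0 \<le> y s" and st: "0 \<le> s" "s \<le> t"
    and \<Phi>: "\<And>r. s \<le> r \<Longrightarrow> \<Phi> r \<le> B - a r * y r"
  shows "y t \<le> exp L * (exp (- (\<delta> * (t - s))) * y s + B / \<delta>)"
proof -
  have ca: "continuous_on {s..u} a" for u using a by (rule continuous_on_subset) (use st in auto)
  define e where "e r = exp (integral {s..r} a)" for r
  have e_pos: "0 < e r" for r by (simp add: e_def)
  have e_s: "e s = 1" by (simp add: e_def)
  have de: "((\<lambda>r. a r * e r) has_integral (e u - e s)) {s..u}" if "u \<in> {s..t}" for u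
  proof (rule fundamental_theorem_of_calculus)
    fix r assume "r \<in> {s..u}"
    then have "(e has_real_derivative (exp (integral {s..r} a) * a r)) (at r within {s..u})"
      unfolding e_def by (intro DERIV_chain2[OF DERIV_exp] integral_has_real_derivative ca)
    then show "(e has_vector_derivative (a r * e r)) (at r within {s..u})"
      by (simp add: has_real_derivative_iff_has_vector_derivative e_def mult.commute)
  qed (use that in auto)
  have ce: "continuous_on {s..t} e"
    unfolding e_def by (intro continuous_intros indefinite_integral_continuous_1 integrable_continuous_real ca)
  have "bounded ((\<lambda>r. a r * e r) ` {s..t})"
    by (intro compact_imp_bounded compact_continuous_image continuous_intros ca ce) auto
  then obtain D where D: "\<And>r. r \<in> {s..t} \<Longrightarrow> norm (a r * e r) \<le> D"
    unfolding bounded_iff by blast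
  obtain C where "\<forall>r\<in>{0..t}. \<bar>\<Phi> r\<bar> \<le> C" using bdd by blast
  then have C: "\<And>r. r \<in> {s..t} \<Longrightarrow> norm (\<Phi> r) \<le> C" using st by simp
  have prod: "((\<lambda>r. \<Phi> r * e r + y r * (a r * e r)) has_integral (y t * e t - y s * e s)) {s..t}"
    by (rule has_integral_bilinear_product[OF bounded_bilinear_mult st(2) _ de C D])
       (use y st in auto)
  have growth: "e r * exp (\<delta> * (t - r) - L) \<le> e t" if r: "r \<in> {s..t}" for r
  proof -
    have "integral {s..t} a = integral {s..r} a + integral {r..t} a"
      using r by (intro Henstock_Kurzweil_Integration.integral_combine[symmetric] integrable_continuous_real ca) auto
    then show ?thesis using lower[of r t] r st by (simp add: e_def flip: exp_add)
  qed
  \<comment> \<open>\<open>\<delta> * q\<close> majorises \<open>B * e\<close> by the growth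
    estimate and is the derivative of \<open>q\<close>, so the integral of the forcing is at most
    \<open>q t\<close>, which is \<open>e t * exp L * B / \<delta>\<close>.\<close>
  define q where "q r = B * e t * exp L / \<delta> * exp (- (\<delta> * (t - r)))" for r
  have dq: "((\<lambda>r. \<delta> * q r) has_integral (q t - q s)) {s..t}"
  proof (rule fundamental_theorem_of_calculus[OF st(2)])
    fix r
    have "(q has_real_derivative (\<delta> * q r)) (at r within {s..t})"
      unfolding q_def using \<open>0 < \<delta>\<close> by (auto intro!: derivative_eq_intros)
    then show "(q has_vector_derivative (\<delta> * q r)) (at r within {s..t})"
      by (simp add: has_real_derivative_iff_has_vector_derivative)
  qed
  have "y t * e t - y s * e s \<le> q t - q s"
  proof (rule has_integral_le[OF prod dq])
    fix r assume r: "r \<in> {s..t}"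
    have "\<Phi> r * e r + y r * (a r * e r) = (\<Phi> r + a r * y r) * e r" by (simp add: algebra_simps)
    also have "\<dots> \<le> B * e r" using \<Phi>[of r] r e_pos[of r] by (intro mult_right_mono) auto
    also have "\<dots> \<le> B * (e t * (exp L * exp (- (\<delta> * (t - r)))))"
    proof (intro mult_left_mono \<open>0 \<le> B\<close>)
      have "e r = e r * exp (\<delta> * (t - r) - L) * (exp L * exp (- (\<delta> * (t - r))))"
        by (simp add: mult.assoc flip: exp_add)
      also have "\<dots> \<le> e t * (exp L * exp (- (\<delta> * (t - r))))"
        using growth[OF r] by (intro mult_right_mono) auto
      finally show "e r \<le> e t * (exp L * exp (- (\<delta> * (t - r))))" .
    qed
    also have "\<dots> = \<delta> * q r" using \<open>0 < \<delta>\<close> by (simp add: q_def)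
    finally show "\<Phi> r * e r + y r * (a r * e r) \<le> \<delta> * q r" .
  qed
  moreover have "0 \<le> q s" using e_pos[of t] \<open>0 \<le> B\<close> \<open>0 < \<delta>\<close> by (simp add: q_def)
  moreover have "q t = e t * (exp L * (B / \<delta>))" by (simp add: q_def)
  moreover have "y s \<le> e t * (exp L * (exp (- (\<delta> * (t - s))) * y s))"
  proof -
    have "y s = e s * exp (\<delta> * (t - s) - L) * (exp L * (exp (- (\<delta> * (t - s))) * y s))"
      by (simp add: e_s flip: exp_add mult.assoc)
    also have "\<dots> \<le> e t * (exp L * (exp (- (\<delta> * (t - s))) * y s))"
      using growth[of s] st \<open>0 \<le> y s\<close> by (intro mult_right_mono) auto
    finally show ?thesis .
  qed
  ultimately have "e t * y t \<le> e t * (exp L * (exp (- (\<delta> * (t - s))) * y s + B / \<delta>))"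
    by (simp add: e_s algebra_simps)
  then show ?thesis using e_pos[of t] by simp
qed

section \<open>Integrating lattice sums term by term\<close>

lemma sum_box_tendsto_infsum:
  fixes f :: "int \<times> int \<Rightarrow> real"
  assumes "f summable_on UNIV"
  shows "(\<lambda>n. sum f ({-int n..int n} \<times> {-int n..int n})) \<longlonglongrightarrow> infsum f UNIV"
proof -
  \<comment> \<open>\<open>infsum\<close> is a limit along the net of finite sets, whereas dominated
    convergence needs a sequence; the boxes form a cofinal one.\<close>
  have "filterlim (\<lambda>n. {-int n..int n} \<times> {-int n..int n}) (finite_subsets_at_top UNIV) sequentially"
    unfolding filterlim_finite_subsets_at_top
  proof (intro allI impI)
    fix X :: "(int \<times> int) set" assume X: "finite X \<and> X \<subseteq> UNIV"
    define N where "N = nat (\<Sum>p\<in>X. \<bar>fst p\<bar> + \<bar>snd p\<bar>)"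
    have "X \<subseteq> {-int n..int n} \<times> {-int n..int n}" if "N \<le> n" for n
    proof
      fix p assume "p \<in> X"
      then have "\<bar>fst p\<bar> + \<bar>snd p\<bar> \<le> (\<Sum>p\<in>X. \<bar>fst p\<bar> + \<bar>snd p\<bar>)"
        using X by (intro member_le_sum) auto
      then have "\<bar>fst p\<bar> + \<bar>snd p\<bar> \<le> int n" using that unfolding N_def by linarith
      then show "p \<in> {-int n..int n} \<times> {-int n..int n}" by (auto simp: mem_Times_iff)
    qed
    then show "\<forall>\<^sub>F n in sequentially. finite ({-int n..int n} \<times> {-int n..int n}) \<and>
        X \<subseteq> {-int n..int n} \<times> {-int n..int n} \<and> {-int n..int n} \<times> {-int n..int n} \<subseteq> UNIV"
      unfolding eventually_sequentially by auto
  qed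
  then show ?thesis
    using has_sum_infsum[OF assms] unfolding has_sum_def by (rule filterlim_compose[rotated])
qed

text \<open>The bound \<open>C\<close> on the absolute sums dominates the partial sums over all
  boxes at once, so integrability in time of the full sum is a result of dominated
  convergence.\<close>

lemma has_integral_infsum:
  fixes f :: "int \<times> int \<Rightarrow> real \<Rightarrow> real"
  assumes f: "\<And>k. (f k has_integral I k) {a..b}" and I: "I summable_on UNIV"
    and s: "\<And>r. r \<in> {a..b} \<Longrightarrow> (\<lambda>k. \<bar>f k r\<bar>) summable_on UNIV"
    and C: "\<And>r. r \<in> {a..b} \<Longrightarrow> (\<Sum>\<^sub>\<infinity>k. \<bar>f k r\<bar>) \<le> C"
  shows "((\<lambda>r. \<Sum>\<^sub>\<infinity>k. f k r) has_integral infsum I UNIV) {a..b}"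
proof -
  let ?box = "\<lambda>n. {-int n..int n} \<times> {-int n..int n}"
  have h: "((\<lambda>r. \<Sum>k\<in>?box n. f k r) has_integral sum I (?box n)) {a..b}" for n
    using f by (intro has_integral_sum) auto
  have le: "norm (\<Sum>k\<in>?box n. f k r) \<le> C" if "r \<in> {a..b}" for n r
  proof -
    have "norm (\<Sum>k\<in>?box n. f k r) \<le> (\<Sum>k\<in>?box n. \<bar>f k r\<bar>)" by (simp add: sum_abs)
    also have "\<dots> \<le> (\<Sum>\<^sub>\<infinity>k. \<bar>f k r\<bar>)" using s[OF that] by (intro finite_sum_le_infsum) auto
    finally show ?thesis using C[OF that] by simp
  qed
  have lim: "(\<lambda>n. \<Sum>k\<in>?box n. f k r) \<longlonglongrightarrow> (\<Sum>\<^sub>\<infinity>k. f k r)" if "r \<in> {a..b}" for r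
    by (rule sum_box_tendsto_infsum, rule abs_summable_summable) (use s[OF that] in simp)
  have h1: "\<And>n. (\<lambda>r. \<Sum>k\<in>?box n. f k r) integrable_on {a..b}" using h by auto
  have h2: "(\<lambda>_. C) integrable_on {a..b}" by auto
  note dc = dominated_convergence[OF h1 h2 le lim]
  have "(\<lambda>n. sum I (?box n)) \<longlonglongrightarrow> integral {a..b} (\<lambda>r. \<Sum>\<^sub>\<infinity>k. f k r)"
    using dc(2) integral_unique[OF h] by simp
  with sum_box_tendsto_infsum[OF I] have "integral {a..b} (\<lambda>r. \<Sum>\<^sub>\<infinity>k. f k r) = infsum I UNIV"
    using LIMSEQ_unique by blast
  then show ?thesis using dc(1) integrable_integral by fastforce
qed

section \<open>The nonlinear term\<close>

text \<open>Fubini for absolutely summable double families. It lets a double sum be read as a sum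
  over the modes \<open>k\<close> of convolution sums over \<open>p\<close>, with the absolute
  values of the latter still controlled.\<close>

lemma infsum_double_abs:
  fixes f :: "'a \<Rightarrow> 'b \<Rightarrow> real"
  assumes "(\<lambda>(x,y). \<bar>f x y\<bar>) summable_on UNIV"
  shows "f x summable_on UNIV"
    and "(\<lambda>x. \<bar>infsum (f x) UNIV\<bar>) summable_on UNIV"
    and "(\<Sum>\<^sub>\<infinity>x. \<bar>infsum (f x) UNIV\<bar>) \<le> (\<Sum>\<^sub>\<infinity>(x,y). \<bar>f x y\<bar>)"
    and "(\<Sum>\<^sub>\<infinity>x. infsum (f x) UNIV) = (\<Sum>\<^sub>\<infinity>(x,y). f x y)"
proof -
  have a: "(\<lambda>(x,y). \<bar>f x y\<bar>) summable_on UNIV \<times> UNIV" using assms by simp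
  have f: "(\<lambda>(x,y). f x y) summable_on UNIV \<times> UNIV"
    by (rule abs_summable_summable) (use a in \<open>simp add: case_prod_unfold\<close>)
  have ax: "(\<lambda>y. \<bar>f x y\<bar>) summable_on UNIV" for x
    using summable_on_SigmaD1[OF a] by auto
  show fx: "f x summable_on UNIV" for x
    using summable_on_SigmaD1[OF f] by auto
  have s: "(\<lambda>x. \<Sum>\<^sub>\<infinity>y. \<bar>f x y\<bar>) summable_on UNIV"
    using summable_on_Sigma_banach[OF a] by simp
  have le: "\<bar>infsum (f x) UNIV\<bar> \<le> (\<Sum>\<^sub>\<infinity>y. \<bar>f x y\<bar>)" for x
    using norm_infsum_bound[of "f x" UNIV] ax[of x] by simp
  show sx: "(\<lambda>x. \<bar>infsum (f x) UNIV\<bar>) summable_on UNIV"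
    using s le by (rule summable_on_comparison_test) auto
  have "(\<Sum>\<^sub>\<infinity>x. \<bar>infsum (f x) UNIV\<bar>) \<le> (\<Sum>\<^sub>\<infinity>x. \<Sum>\<^sub>\<infinity>y. \<bar>f x y\<bar>)"
    using sx s le by (rule infsum_mono)
  also have "\<dots> = (\<Sum>\<^sub>\<infinity>(x,y). \<bar>f x y\<bar>)"
    using infsum_Sigma'_banach[OF a] by simp
  finally show "(\<Sum>\<^sub>\<infinity>x. \<bar>infsum (f x) UNIV\<bar>) \<le> (\<Sum>\<^sub>\<infinity>(x,y). \<bar>f x y\<bar>)" .
  show "(\<Sum>\<^sub>\<infinity>x. infsum (f x) UNIV) = (\<Sum>\<^sub>\<infinity>(x,y). f x y)"
    using infsum_Sigma'_banach[OF f] by simp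
qed

section \<open>Energy, enstrophy and Poincare's inequality\<close>

definition energy :: "field \<Rightarrow> real" where
  "energy u = (\<Sum>\<^sub>\<infinity>k. (norm (u k))\<^sup>2)"

definition enstrophy :: "field \<Rightarrow> real" where
  "enstrophy u = (\<Sum>\<^sub>\<infinity>k. knorm2 k * (norm (u k))\<^sup>2)"

lemma cnorm2_eq: "cnorm2 a = (norm a)\<^sup>2"
  by (simp add: cnorm2_def norm_prod_def)

lemma energy_nonneg: "0 \<le> energy u"
  by (simp add: energy_def infsum_nonneg)

lemma enstrophy_nonneg: "0 \<le> enstrophy u"
  by (simp add: enstrophy_def infsum_nonneg knorm2_nonneg)

lemma enstrophy_alt: "enstrophy u = (\<Sum>\<^sub>\<infinity>k. (sqrt (knorm2 k) * norm (u k))\<^sup>2)"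
  by (simp add: enstrophy_def power_mult_distrib knorm2_nonneg)

lemma Hnorm_eq: "Hnorm u = 2 * pi * sqrt (energy u)"
  by (simp add: Hnorm_def energy_def cnorm2_eq real_sqrt_mult)

lemma Vnorm_eq: "Vnorm u = 2 * pi * sqrt (enstrophy u)"
  by (simp add: Vnorm_def enstrophy_def cnorm2_eq real_sqrt_mult)

lemma in_H_summable: "in_H u \<Longrightarrow> (\<lambda>k. (norm (u k))\<^sup>2) summable_on UNIV"
  by (simp add: in_H_def cnorm2_eq)

lemma in_V_summable:
  assumes "in_V u"
  shows "(\<lambda>k. (norm (u k))\<^sup>2) summable_on UNIV"
    and "(\<lambda>k. knorm2 k * (norm (u k))\<^sup>2) summable_on UNIV"
    and "(\<lambda>k. (sqrt (knorm2 k) * norm (u k))\<^sup>2) summable_on UNIV"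
  using assms by (auto simp: in_V_def in_H_summable cnorm2_eq power_mult_distrib knorm2_nonneg)

lemma in_V_imp_in_H: "in_V u \<Longrightarrow> in_H u"
  by (simp add: in_V_def)

lemma in_H_mode:
  assumes "in_H u"
  shows "kdot k (u k) = 0" and "k = (0,0) \<Longrightarrow> u k = 0"
  using assms unfolding in_H_def zero_prod_def by blast+

lemma energy_sqrt_triangle:
  assumes "in_H u" "in_H v"
  shows "sqrt (energy (\<lambda>k. u k - v k)) \<le> sqrt (energy u) + sqrt (energy v)"
    and "(\<lambda>k. (norm (u k - v k))\<^sup>2) summable_on UNIV"
  unfolding energy_def
  using infsum_Minkowski[OF in_H_summable[OF assms(1)] in_H_summable[OF assms(2)], of "\<lambda>k. norm (u k - v k)"]
  by (auto simp: norm_triangle_ineq4)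

lemma enstrophy_sqrt_triangle:
  assumes "in_V u" "in_V v"
  shows "sqrt (enstrophy (\<lambda>k. u k - v k)) \<le> sqrt (enstrophy u) + sqrt (enstrophy v)"
    and "(\<lambda>k. (sqrt (knorm2 k) * norm (u k - v k))\<^sup>2) summable_on UNIV"
proof -
  have "\<bar>sqrt (knorm2 k) * norm (u k - v k)\<bar> \<le> sqrt (knorm2 k) * norm (u k) + sqrt (knorm2 k) * norm (v k)" for k
    using mult_left_mono[OF norm_triangle_ineq4[of "u k" "v k"], of "sqrt (knorm2 k)"]
    by (simp add: knorm2_nonneg distrib_left)
  note * = infsum_Minkowski[OF in_V_summable(3)[OF assms(1)] in_V_summable(3)[OF assms(2)] this]
  from * show "sqrt (enstrophy (\<lambda>k. u k - v k)) \<le> sqrt (enstrophy u) + sqrt (enstrophy v)"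
    and "(\<lambda>k. (sqrt (knorm2 k) * norm (u k - v k))\<^sup>2) summable_on UNIV"
    unfolding enstrophy_alt by auto
qed

lemma kdot_diff: "kdot k (a - b) = kdot k a - kdot k b"
  by (simp add: kdot_def algebra_simps)

lemma pconj_diff: "pconj (a - b) = pconj a - pconj b"
  by (simp add: pconj_def)

lemma in_H_diff:
  assumes "in_H u" "in_H v"
  shows "in_H (\<lambda>k. u k - v k)"
  unfolding in_H_def
  using assms energy_sqrt_triangle(2)[OF assms]
  by (auto simp: in_H_def kdot_diff pconj_diff cnorm2_eq zero_prod_def)

lemma in_V_diff:
  assumes "in_V u" "in_V v"
  shows "in_V (\<lambda>k. u k - v k)"
  unfolding in_V_def
  using assms enstrophy_sqrt_triangle(2)[OF assms] in_H_diff[of u v]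
  by (auto simp: in_V_def cnorm2_eq power_mult_distrib knorm2_nonneg)

text \<open>Poincare's inequality with constant 1: the mean vanishes and every other wave vector has
  length at least 1.\<close>

lemma energy_le_enstrophy:
  assumes "in_V u"
  shows "energy u \<le> enstrophy u"
  unfolding energy_def enstrophy_def
proof (intro infsum_mono in_V_summable[OF assms])
  fix k
  show "(norm (u k))\<^sup>2 \<le> knorm2 k * (norm (u k))\<^sup>2"
  proof (cases "k = (0,0)")
    case True
    then show ?thesis using assms by (simp add: in_V_def in_H_def flip: zero_prod_def)
  next
    case False
    then show ?thesis using mult_right_mono[OF knorm2_ge_1[OF False], of "(norm (u k))\<^sup>2"] by simp
  qed
qed

text \<open>Each mode is either kept by \<open>PN\<close> or satisfies N^2 \<le> |k|^2, so the
  inequality already holds mode by mode; the zero mode of the difference vanishes.\<close>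

lemma high_modes_bound:
  assumes u: "in_V u" and v: "in_V v" and N: "0 \<le> N"
  shows "N\<^sup>2 * (energy (\<lambda>k. u k - v k) - energy (\<lambda>k. PN N u k - PN N v k)) \<le> enstrophy (\<lambda>k. u k - v k)"
proof -
  let ?w = "\<lambda>k. u k - v k" and ?P = "\<lambda>k. PN N u k - PN N v k"
  note w = in_V_diff[OF u v]
  have P: "?P k = (if k \<noteq> (0,0) \<and> sqrt (knorm2 k) \<le> N then ?w k else 0)" for k
    by (simp add: PN_def zero_prod_def)
  have sP: "(\<lambda>k. (norm (?P k))\<^sup>2) summable_on UNIV"
    using in_V_summable(1)[OF w] by (rule summable_on_comparison_test) (auto simp: P)
  have "N\<^sup>2 * energy ?w \<le> N\<^sup>2 * energy ?P + enstrophy ?w"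
  proof -
    have "N\<^sup>2 * energy ?w = (\<Sum>\<^sub>\<infinity>k. N\<^sup>2 * (norm (?w k))\<^sup>2)"
      unfolding energy_def by (simp add: infsum_cmult_right')
    also have "\<dots> \<le> (\<Sum>\<^sub>\<infinity>k. N\<^sup>2 * (norm (?P k))\<^sup>2 + knorm2 k * (norm (?w k))\<^sup>2)"
    proof (intro infsum_mono summable_on_add summable_on_cmult_right sP in_V_summable[OF w])
      fix k
      show "N\<^sup>2 * (norm (?w k))\<^sup>2 \<le> N\<^sup>2 * (norm (?P k))\<^sup>2 + knorm2 k * (norm (?w k))\<^sup>2"
      proof (cases "k = (0,0)")
        case True
        then have "?w k = 0" using w by (simp add: in_V_def in_H_def zero_prod_def)
        then show ?thesis by (simp add: P)
      next
        case False
        show ?thesis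
        proof (cases "sqrt (knorm2 k) \<le> N")
          case True
          then show ?thesis using False by (simp add: P knorm2_nonneg)
        next
          case nle: False
          then have "N\<^sup>2 \<le> (sqrt (knorm2 k))\<^sup>2" using N by (intro power_mono) auto
          then have "N\<^sup>2 \<le> knorm2 k" by (simp add: knorm2_nonneg)
          then show ?thesis using nle by (simp add: P mult_right_mono)
        qed
      qed
    qed
    also have "\<dots> = N\<^sup>2 * energy ?P + enstrophy ?w"
      unfolding energy_def enstrophy_def
      by (subst infsum_add) (auto intro!: summable_on_cmult_right sP in_V_summable[OF w] simp: infsum_cmult_right')
    finally show ?thesis .
  qed
  then show ?thesis by (simp add: algebra_simps)
qed

section \<open>Leray projection and the convective term\<close>

lemma kdot_bound: "cmod (kdot k a) \<le> sqrt (knorm2 k) * norm a"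
proof -
  have "cmod (kdot k a) \<le> \<bar>of_int (fst k)\<bar> * \<bar>cmod (fst a)\<bar> + \<bar>of_int (snd k)\<bar> * \<bar>cmod (snd a)\<bar>"
    unfolding kdot_def by (rule order_trans[OF norm_triangle_ineq]) (simp add: norm_mult)
  \<comment> \<open>The two-point index set presents the pairing in C^2 as an instance of the
    Cauchy-Schwarz inequality for \<open>L2_set\<close>.\<close>
  also have "\<dots> = (\<Sum>i\<in>{True,False}. \<bar>if i then of_int (fst k) else of_int (snd k)\<bar>
      * \<bar>if i then cmod (fst a) else cmod (snd a)\<bar>)" by simp
  also have "\<dots> \<le> L2_set (\<lambda>i. if i then of_int (fst k) else of_int (snd k)) {True,False}
      * L2_set (\<lambda>i. if i then cmod (fst a) else cmod (snd a)) {True,False}"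
    by (rule L2_set_mult_ineq)
  also have "\<dots> = sqrt (knorm2 k) * norm a"
    by (simp add: L2_set_def knorm2_def norm_prod_def)
  finally show ?thesis .
qed

lemma inner_kdot:
  "inner w (z * of_int (fst k), z * of_int (snd k)) = Re (z * cnj (kdot k w))"
  by (simp add: inner_prod_def inner_complex_def kdot_def algebra_simps)

text \<open>The Leray correction is a complex multiple of \<open>k\<close>, and by
  \<open>inner_kdot\<close> its real inner product with \<open>w\<close> vanishes when k . w = 0.
  Testing with a divergence-free field therefore removes the projection, that is, the
  pressure.\<close>

lemma inner_leray:
  assumes "kdot k w = 0" "k = (0,0) \<Longrightarrow> w = 0"
  shows "inner w (leray F k) = inner w (F k)"
proof (cases "k = (0,0)")
  case True
  then show ?thesis using assms by simp
next
  case False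
  let ?z = "kdot k (F k) / of_real (knorm2 k)"
  have "leray F k = F k - (?z * of_int (fst k), ?z * of_int (snd k))"
    using False by (cases "F k") (simp add: leray_def)
  then have "inner w (leray F k) = inner w (F k) - inner w (?z * of_int (fst k), ?z * of_int (snd k))"
    by (simp only: inner_diff_right)
  then show ?thesis unfolding inner_kdot using assms by simp
qed

lemma norm_scaled_wave_vector:
  "norm (z * of_int (fst k), z * of_int (snd k) :: complex) = cmod z * sqrt (knorm2 k)"
  by (simp add: norm_prod_def norm_mult power_mult_distrib knorm2_def real_sqrt_mult flip: distrib_left)

text \<open>The constant 2 is what the triangle inequality gives, not the optimal 1; the bound
  serves only to keep single modes bounded in time.\<close>

lemma norm_leray_le: "norm (leray F k) \<le> 2 * norm (F k)"
proof (cases "k = (0,0)")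
  case True
  then show ?thesis by (simp add: leray_def flip: zero_prod_def)
next
  case False
  let ?z = "kdot k (F k) / of_real (knorm2 k)"
  have k: "0 < knorm2 k" using knorm2_ge_1[OF False] by simp
  have "leray F k = F k - (?z * of_int (fst k), ?z * of_int (snd k))"
    using False by (cases "F k") (simp add: leray_def)
  then have "norm (leray F k) \<le> norm (F k) + norm (?z * of_int (fst k), ?z * of_int (snd k))"
    by (metis norm_triangle_ineq4)
  also have "norm (?z * of_int (fst k), ?z * of_int (snd k)) = cmod ?z * sqrt (knorm2 k)"
    by (rule norm_scaled_wave_vector)
  also have "cmod ?z = cmod (kdot k (F k)) / knorm2 k"
    using k by (simp add: norm_divide)
  also have "\<dots> * sqrt (knorm2 k) \<le> (sqrt (knorm2 k) * norm (F k)) / knorm2 k * sqrt (knorm2 k)"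
    using kdot_bound k by (intro mult_right_mono divide_right_mono) auto
  also have "\<dots> = norm (F k)" using k by (simp add: field_simps)
  finally show ?thesis by simp
qed

definition convect_term :: "field \<Rightarrow> field \<Rightarrow> int \<times> int \<Rightarrow> int \<times> int \<Rightarrow> complex \<times> complex" where
  "convect_term u v k p =
     (\<i> * kdot (k - p) (u p) * fst (v (k - p)), \<i> * kdot (k - p) (u p) * snd (v (k - p)))"

lemma norm_convect_term_le:
  "norm (convect_term u v k p) \<le> norm (u p) * (sqrt (knorm2 (k - p)) * norm (v (k - p)))"
proof -
  have "norm (convect_term u v k p) = cmod (kdot (k - p) (u p)) * norm (v (k - p))"
    by (simp add: convect_term_def norm_prod_def norm_mult power_mult_distrib real_sqrt_mult flip: distrib_left)
  also have "\<dots> \<le> (sqrt (knorm2 (k - p)) * norm (u p)) * norm (v (k - p))"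
    by (intro mult_right_mono kdot_bound) auto
  finally show ?thesis by (simp add: mult_ac)
qed

text \<open>Among the possible splittings of the difference this one puts the gradient of
  \<open>w\<close> next to \<open>u1\<close>, in the term that cancels when tested with
  \<open>w\<close>. What remains involves only the gradient of \<open>u2\<close>.\<close>

lemma convect_term_bilinear:
  "convect_term u1 u1 k p - convect_term u2 u2 k p =
   convect_term u1 (\<lambda>k. u1 k - u2 k) k p + convect_term (\<lambda>k. u1 k - u2 k) u2 k p"
  by (simp add: convect_term_def kdot_diff algebra_simps)

lemma convect_summable:
  assumes u: "in_V u" and v: "in_V v"
  shows "(\<lambda>p. convect_term u v k p) summable_on UNIV"
    and "convect u v k = (\<Sum>\<^sub>\<infinity>p. convect_term u v k p)"
    and "norm (convect u v k) \<le> sqrt (energy u) * sqrt (enstrophy v)"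
proof -
  have bij: "bij_betw (\<lambda>p. k - p) UNIV UNIV"
    by (rule bij_betw_byWitness[where f'="\<lambda>p. k - p"]) auto
  let ?f = "\<lambda>p. norm (u p)" and ?g = "\<lambda>p. sqrt (knorm2 (k - p)) * norm (v (k - p))"
  have g: "(\<lambda>p. (?g p)\<^sup>2) summable_on UNIV"
    using summable_on_reindex_bij_betw[OF bij, of "\<lambda>q. (sqrt (knorm2 q) * norm (v q))\<^sup>2"] in_V_summable(3)[OF v]
    by simp
  have gs: "(\<Sum>\<^sub>\<infinity>p. (?g p)\<^sup>2) = enstrophy v"
    using infsum_reindex_bij_betw[OF bij, of "\<lambda>q. (sqrt (knorm2 q) * norm (v q))\<^sup>2"]
    by (simp add: enstrophy_alt)
  note cs = infsum_Cauchy_Schwarz[OF in_V_summable(1)[OF u] g]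
  have le: "norm (convect_term u v k p) \<le> \<bar>?f p * ?g p\<bar>" for p
    using norm_convect_term_le[of u v k p] by linarith
  have abs: "(\<lambda>p. norm (convect_term u v k p)) summable_on UNIV"
    using cs(1) le by (rule Infinite_Sum.abs_summable_on_comparison_test')
  show s: "(\<lambda>p. convect_term u v k p) summable_on UNIV"
    using abs by (rule abs_summable_summable)
  \<comment> \<open>\<open>convect\<close> is defined by two scalar sums. Summability in
    \<open>complex \<times> complex\<close> lets the projections commute with the sum, so that it
    can be treated as one vector sum.\<close>
  have "fst (\<Sum>\<^sub>\<infinity>p. convect_term u v k p) = (\<Sum>\<^sub>\<infinity>p. fst (convect_term u v k p))"
    "snd (\<Sum>\<^sub>\<infinity>p. convect_term u v k p) = (\<Sum>\<^sub>\<infinity>p. snd (convect_term u v k p))"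
    by (intro infsumI[symmetric] has_sum_bounded_linear[OF bounded_linear_fst]
        has_sum_bounded_linear[OF bounded_linear_snd] has_sum_infsum s)+
  then show e: "convect u v k = (\<Sum>\<^sub>\<infinity>p. convect_term u v k p)"
    by (simp add: prod_eq_iff convect_def convect_term_def)
  have "norm (convect u v k) \<le> (\<Sum>\<^sub>\<infinity>p. norm (convect_term u v k p))"
    unfolding e by (rule norm_infsum_bound[OF abs])
  also have "\<dots> \<le> (\<Sum>\<^sub>\<infinity>p. \<bar>?f p * ?g p\<bar>)"
    using abs cs(1) le by (intro infsum_mono) auto
  also have "\<dots> \<le> sqrt (energy u) * sqrt (enstrophy v)"
    using cs(2) unfolding gs energy_def .
  finally show "norm (convect u v k) \<le> sqrt (energy u) * sqrt (enstrophy v)" .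
qed

lemma norm_Bop_le:
  assumes "in_V u"
  shows "norm (Bop u u k) \<le> 2 * enstrophy u"
proof -
  have "norm (Bop u u k) \<le> 2 * norm (convect u u k)"
    unfolding Bop_def by (rule norm_leray_le)
  also have "\<dots> \<le> 2 * (sqrt (enstrophy u) * sqrt (enstrophy u))"
    using energy_le_enstrophy[OF assms] enstrophy_nonneg[of u]
    by (intro mult_left_mono order_trans[OF convect_summable(3)[OF assms assms]] mult_right_mono) auto
  finally show ?thesis by (simp add: enstrophy_nonneg)
qed

section \<open>The trilinear form b(u, v, w) in Fourier variables\<close>

definition triform :: "field \<Rightarrow> field \<Rightarrow> field \<Rightarrow> int \<times> int \<Rightarrow> int \<times> int \<Rightarrow> real" where
  "triform u v w k p = inner (w k) (convect_term u v k p)"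

text \<open>The lattice inequality carries the same sequence in both outer slots, hence the common
  majorant \<open>m\<close> of \<open>u\<close> and \<open>w\<close>; the middle factor enters
  through the modes of its gradient.\<close>

lemma triform_summable:
  assumes m: "trilinear m (\<lambda>q. sqrt (knorm2 q) * norm (v q))"
    and u_le: "\<And>p. norm (u p) \<le> m p" and w_le: "\<And>p. norm (w p) \<le> m p" and R: "R \<ge> 1"
  shows "(\<lambda>(k,p). \<bar>triform u v w k p\<bar>) summable_on UNIV"
    and "(\<Sum>\<^sub>\<infinity>(k,p). \<bar>triform u v w k p\<bar>) \<le>
      10 * sqrt (enstrophy v) * (R * (\<Sum>\<^sub>\<infinity>p. (m p)\<^sup>2) + (\<Sum>\<^sub>\<infinity>p. knorm2 p * (m p)\<^sup>2) / R)"
proof -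
  interpret trilinear m "\<lambda>q. sqrt (knorm2 q) * norm (v q)" by (rule m)
  let ?b = "\<lambda>q. sqrt (knorm2 q) * norm (v q)"
  let ?G = "\<lambda>(p,k). m p * m k * ?b (k - p)"
  let ?H = "\<lambda>(k,p). m p * m k * ?b (k - p)"
  have swap: "bij_betw prod.swap UNIV UNIV" by simp
  have H: "?H = (\<lambda>x. ?G (prod.swap x))" by auto
  have Hs: "?H summable_on UNIV"
    unfolding H using trilinear_sum(1)[OF R] by (simp only: summable_on_reindex_bij_betw[OF swap])
  have Hi: "infsum ?H UNIV = infsum ?G UNIV"
    unfolding H by (rule infsum_reindex_bij_betw[OF swap])
  have le: "(\<lambda>(k,p). \<bar>triform u v w k p\<bar>) x \<le> ?H x" for x
  proof -
    obtain k p where Pair: "x = (k, p)" by (metis surj_pair)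
    have "\<bar>triform u v w k p\<bar> \<le> norm (w k) * norm (convect_term u v k p)"
      unfolding triform_def by (rule Cauchy_Schwarz_ineq2)
    also have "\<dots> \<le> m k * (m p * ?b (k - p))"
      by (intro mult_mono order_trans[OF norm_convect_term_le] mult_right_mono u_le w_le b_nonneg m_nonneg) auto
    finally show ?thesis using Pair by (simp add: mult_ac)
  qed
  show s: "(\<lambda>(k,p). \<bar>triform u v w k p\<bar>) summable_on UNIV"
    using Hs le by (rule summable_on_comparison_test) auto
  have "(\<Sum>\<^sub>\<infinity>(k,p). \<bar>triform u v w k p\<bar>) \<le> infsum ?H UNIV"
    using s Hs le by (rule infsum_mono)
  also have "\<dots> \<le> 10 * sqrt (enstrophy v) * (R * (\<Sum>\<^sub>\<infinity>p. (m p)\<^sup>2) + (\<Sum>\<^sub>\<infinity>p. knorm2 p * (m p)\<^sup>2) / R)"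
    unfolding Hi enstrophy_alt using trilinear_sum(2)[OF R] .
  finally show "(\<Sum>\<^sub>\<infinity>(k,p). \<bar>triform u v w k p\<bar>) \<le>
      10 * sqrt (enstrophy v) * (R * (\<Sum>\<^sub>\<infinity>p. (m p)\<^sup>2) + (\<Sum>\<^sub>\<infinity>p. knorm2 p * (m p)\<^sup>2) / R)" .
qed

text \<open>Taking |w| itself for \<open>m\<close> keeps energy and enstrophy apart. With
  \<open>R\<close> still free, the enstrophy part can later be made small compared with the viscous
  dissipation.\<close>

lemma triform_summable_diag:
  assumes v: "in_V v" and w: "in_V w" and R: "R \<ge> 1"
  shows "(\<lambda>(k,p). \<bar>triform w v w k p\<bar>) summable_on UNIV"
    and "(\<Sum>\<^sub>\<infinity>(k,p). \<bar>triform w v w k p\<bar>) \<le> 10 * sqrt (enstrophy v) * (R * energy w + enstrophy w / R)"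
proof -
  have t: "trilinear (\<lambda>p. norm (w p)) (\<lambda>q. sqrt (knorm2 q) * norm (v q))"
    by standard (auto simp: knorm2_nonneg in_V_summable[OF v] in_V_summable[OF w])
  show "(\<lambda>(k,p). \<bar>triform w v w k p\<bar>) summable_on UNIV"
    by (rule triform_summable(1)[OF t _ _ R]) auto
  show "(\<Sum>\<^sub>\<infinity>(k,p). \<bar>triform w v w k p\<bar>) \<le> 10 * sqrt (enstrophy v) * (R * energy w + enstrophy w / R)"
    unfolding energy_def enstrophy_def[of w] by (rule triform_summable(2)[OF t _ _ R]) auto
qed

text \<open>A crude bound with |u| + |w| for \<open>m\<close> and \<open>R = 1\<close>, meant for
  absolute convergence and for majorants on bounded time intervals. The 40 is 10 times 4: both sums
  over \<open>?m\<close> are at most twice the enstrophies of \<open>u\<close> and \<open>w\<close>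
  together.\<close>

lemma triform_summable_general:
  assumes u: "in_V u" and v: "in_V v" and w: "in_V w"
  shows "(\<lambda>(k,p). \<bar>triform u v w k p\<bar>) summable_on UNIV"
    and "(\<Sum>\<^sub>\<infinity>(k,p). \<bar>triform u v w k p\<bar>) \<le> 40 * sqrt (enstrophy v) * (enstrophy u + enstrophy w)"
proof -
  let ?m = "\<lambda>p. norm (u p) + norm (w p)"
  have sq: "(?m p)\<^sup>2 \<le> 2 * (norm (u p))\<^sup>2 + 2 * (norm (w p))\<^sup>2" for p
    using sum_squares_bound[of "norm (u p)" "norm (w p)"] by (simp add: power2_sum)
  have ksq: "knorm2 p * (?m p)\<^sup>2 \<le> 2 * (knorm2 p * (norm (u p))\<^sup>2) + 2 * (knorm2 p * (norm (w p))\<^sup>2)" for p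
    using mult_left_mono[OF sq[of p] knorm2_nonneg[of p]] by (simp add: algebra_simps)
  have s0: "(\<lambda>p. 2 * (norm (u p))\<^sup>2 + 2 * (norm (w p))\<^sup>2) summable_on UNIV"
    by (intro summable_on_add summable_on_cmult_right in_V_summable u w)
  have s1: "(\<lambda>p. 2 * (knorm2 p * (norm (u p))\<^sup>2) + 2 * (knorm2 p * (norm (w p))\<^sup>2)) summable_on UNIV"
    by (intro summable_on_add summable_on_cmult_right in_V_summable u w)
  have m0: "(\<lambda>p. (?m p)\<^sup>2) summable_on UNIV"
    using s0 sq by (rule summable_on_comparison_test) auto
  have m1: "(\<lambda>p. knorm2 p * (?m p)\<^sup>2) summable_on UNIV"
    using s1 ksq by (rule summable_on_comparison_test) (auto simp: knorm2_nonneg)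
  have t: "trilinear ?m (\<lambda>q. sqrt (knorm2 q) * norm (v q))"
    by standard (use m0 m1 in \<open>auto simp: knorm2_nonneg in_V_summable[OF v]\<close>)
  show "(\<lambda>(k,p). \<bar>triform u v w k p\<bar>) summable_on UNIV"
    by (rule triform_summable(1)[OF t _ _ order_refl]) auto
  have "(\<Sum>\<^sub>\<infinity>p. (?m p)\<^sup>2) \<le> (\<Sum>\<^sub>\<infinity>p. 2 * (norm (u p))\<^sup>2 + 2 * (norm (w p))\<^sup>2)"
    using m0 s0 sq by (rule infsum_mono)
  also have "\<dots> = 2 * energy u + 2 * energy w" unfolding energy_def
    by (subst infsum_add) (auto intro!: summable_on_cmult_right in_V_summable u w simp: infsum_cmult_right')
  also have "\<dots> \<le> 2 * enstrophy u + 2 * enstrophy w"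
    using energy_le_enstrophy[OF u] energy_le_enstrophy[OF w] by simp
  finally have e0: "(\<Sum>\<^sub>\<infinity>p. (?m p)\<^sup>2) \<le> 2 * enstrophy u + 2 * enstrophy w" .
  have "(\<Sum>\<^sub>\<infinity>p. knorm2 p * (?m p)\<^sup>2) \<le> (\<Sum>\<^sub>\<infinity>p. 2 * (knorm2 p * (norm (u p))\<^sup>2) + 2 * (knorm2 p * (norm (w p))\<^sup>2))"
    using m1 s1 ksq by (rule infsum_mono)
  also have "\<dots> = 2 * enstrophy u + 2 * enstrophy w" unfolding enstrophy_def
    by (subst infsum_add) (auto intro!: summable_on_cmult_right in_V_summable u w simp: infsum_cmult_right')
  finally have e1: "(\<Sum>\<^sub>\<infinity>p. knorm2 p * (?m p)\<^sup>2) \<le> 2 * enstrophy u + 2 * enstrophy w" .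
  have "(\<Sum>\<^sub>\<infinity>(k,p). \<bar>triform u v w k p\<bar>) \<le>
      10 * sqrt (enstrophy v) * (1 * (\<Sum>\<^sub>\<infinity>p. (?m p)\<^sup>2) + (\<Sum>\<^sub>\<infinity>p. knorm2 p * (?m p)\<^sup>2) / 1)"
    by (rule triform_summable(2)[OF t _ _ order_refl]) auto
  also have "\<dots> \<le> 10 * sqrt (enstrophy v) * (4 * (enstrophy u + enstrophy w))"
    using e0 e1 by (intro mult_left_mono) (auto simp: enstrophy_nonneg)
  finally show "(\<Sum>\<^sub>\<infinity>(k,p). \<bar>triform u v w k p\<bar>) \<le> 40 * sqrt (enstrophy v) * (enstrophy u + enstrophy w)"
    by (simp add: algebra_simps)
qed

text \<open>The involution \<open>(k, p) \<mapsto> (k - p, -p)\<close> changes the sign of the summand.\<close>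
lemma triform_cancel:
  assumes u: "in_H u"
  shows "(\<Sum>\<^sub>\<infinity>(k,p). triform u w w k p) = 0"
proof -
  let ?T = "\<lambda>(k,p). triform u w w k p"
  let ?s = "\<lambda>(k,p). (k - p, - p) :: (int \<times> int) \<times> (int \<times> int)"
  have bij: "bij_betw ?s UNIV UNIV"
    by (rule bij_betw_byWitness[where f'="?s"]) auto
  have anti: "?T (?s x) = - ?T x" for x
  proof -
    obtain k p where Pair: "x = (k, p)" by (metis surj_pair)
    \<comment> \<open>Reality turns \<open>u (- p)\<close> into \<open>pconj (u p)\<close>, and
      incompressibility gives k . u(p) = (k - p) . u(p). The involution also conjugates the product
      of the two \<open>w\<close> factors, and Re (i conj z) = - Re (i z).\<close>
    have cn: "kdot k (u (- p)) = cnj (kdot (k - p) (u p))"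
    proof -
      have "u (- p) = pconj (u p)" "kdot p (u p) = 0" using u unfolding in_H_def by blast+
      moreover have "kdot k (pconj (u p)) = cnj (kdot k (u p))"
        by (simp add: kdot_def pconj_def)
      moreover have "kdot (k - p) (u p) = kdot k (u p) - kdot p (u p)"
        by (simp add: kdot_def algebra_simps)
      ultimately show ?thesis by simp
    qed
    have 1: "triform u w w k p = Re (\<i> * kdot (k - p) (u p) *
        (fst (w (k - p)) * cnj (fst (w k)) + snd (w (k - p)) * cnj (snd (w k))))"
      by (simp add: triform_def convect_term_def inner_prod_def inner_complex_def algebra_simps)
    have 2: "triform u w w (k - p) (- p) = Re (\<i> * cnj (kdot (k - p) (u p)) *
        cnj (fst (w (k - p)) * cnj (fst (w k)) + snd (w (k - p)) * cnj (snd (w k))))"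
      unfolding triform_def convect_term_def using cn
      by (simp add: inner_prod_def inner_complex_def algebra_simps)
    have "triform u w w (k - p) (- p) = - triform u w w k p"
      unfolding 1 2 by (simp add: algebra_simps)
    then show ?thesis using Pair by simp
  qed
  have "infsum ?T UNIV = (\<Sum>\<^sub>\<infinity>x. ?T (?s x))"
    by (rule infsum_reindex_bij_betw[OF bij, symmetric])
  also have "\<dots> = - infsum ?T UNIV"
    unfolding anti by (rule infsum_uminus)
  finally show ?thesis by simp
qed

text \<open>For each \<open>k\<close> the projection drops out and the term splits into
  \<open>triform u1 w w\<close> and \<open>triform w u2 w\<close>; the first vanishes only after
  summation over \<open>k\<close>. The second claim therefore retains both parts and serves as a
  majorant, while the third exploits the cancellation.\<close>

lemma nonlinear_energy:
  fixes u1 u2 :: field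
  defines "w \<equiv> \<lambda>k. u1 k - u2 k"
  assumes u1: "in_V u1" and u2: "in_V u2"
  shows "(\<lambda>k. \<bar>inner (w k) (Bop u1 u1 k - Bop u2 u2 k)\<bar>) summable_on UNIV"
    and "(\<Sum>\<^sub>\<infinity>k. \<bar>inner (w k) (Bop u1 u1 k - Bop u2 u2 k)\<bar>) \<le>
      40 * sqrt (enstrophy w) * (enstrophy u1 + enstrophy w) + 40 * sqrt (enstrophy u2) * (enstrophy w + enstrophy w)"
    and "R \<ge> 1 \<Longrightarrow> \<bar>\<Sum>\<^sub>\<infinity>k. inner (w k) (Bop u1 u1 k - Bop u2 u2 k)\<bar> \<le>
      10 * sqrt (enstrophy u2) * (R * energy w + enstrophy w / R)"
proof -
  have w: "in_V w" unfolding w_def by (rule in_V_diff[OF u1 u2])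
  let ?n = "\<lambda>k. inner (w k) (Bop u1 u1 k - Bop u2 u2 k)"
  note t1 = triform_summable_general[OF u1 w w] and t2 = triform_summable_general[OF w u2 w]
  note d1 = infsum_double_abs[OF t1(1)] and d2 = infsum_double_abs[OF t2(1)]
  have n: "?n k = infsum (triform u1 w w k) UNIV + infsum (triform w u2 w k) UNIV" for k
  proof -
    have wk: "kdot k (w k) = 0" "k = (0,0) \<Longrightarrow> w k = 0"
      using in_H_mode[OF in_V_imp_in_H[OF w]] by auto
    have "?n k = inner (w k) (convect u1 u1 k) - inner (w k) (convect u2 u2 k)"
      unfolding Bop_def by (simp add: inner_diff_right inner_leray[OF wk])
    also have "\<dots> = inner (w k) ((\<Sum>\<^sub>\<infinity>p. convect_term u1 u1 k p) - (\<Sum>\<^sub>\<infinity>p. convect_term u2 u2 k p))"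
      by (simp add: inner_diff_right convect_summable(2) u1 u2)
    also have "(\<Sum>\<^sub>\<infinity>p. convect_term u1 u1 k p) - (\<Sum>\<^sub>\<infinity>p. convect_term u2 u2 k p)
        = (\<Sum>\<^sub>\<infinity>p. convect_term u1 w k p) + (\<Sum>\<^sub>\<infinity>p. convect_term w u2 k p)"
    proof -
      have "(\<Sum>\<^sub>\<infinity>p. convect_term u1 u1 k p)
          = (\<Sum>\<^sub>\<infinity>p. convect_term u2 u2 k p + (convect_term u1 w k p + convect_term w u2 k p))"
        using convect_term_bilinear[of u1 k _ u2] unfolding w_def 
        by (intro infsum_cong) (metis add_diff_cancel_left' add.commute diff_add_cancel)
      also have "\<dots> = (\<Sum>\<^sub>\<infinity>p. convect_term u2 u2 k p) + ((\<Sum>\<^sub>\<infinity>p. convect_term u1 w k p) + (\<Sum>\<^sub>\<infinity>p. convect_term w u2 k p))"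
        by (simp add: infsum_add summable_on_add convect_summable(1) u1 u2 w)
      finally show ?thesis by simp
    qed
    also have "inner (w k) \<dots> = infsum (triform u1 w w k) UNIV + infsum (triform w u2 w k) UNIV"
      unfolding inner_add_right triform_def
      by (intro arg_cong2[where f="(+)"] infsumI[symmetric] has_sum_bounded_linear[OF bounded_linear_inner_right]
          has_sum_infsum convect_summable(1) u1 u2 w)
    finally show ?thesis .
  qed
  have s: "(\<lambda>k. \<bar>infsum (triform u1 w w k) UNIV\<bar> + \<bar>infsum (triform w u2 w k) UNIV\<bar>) summable_on UNIV"
    by (intro summable_on_add d1 d2)
  have le: "\<bar>?n k\<bar> \<le> \<bar>infsum (triform u1 w w k) UNIV\<bar> + \<bar>infsum (triform w u2 w k) UNIV\<bar>" for k
    unfolding n by linarith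
  show sn: "(\<lambda>k. \<bar>?n k\<bar>) summable_on UNIV"
    using s le by (rule summable_on_comparison_test) auto
  have "(\<Sum>\<^sub>\<infinity>k. \<bar>?n k\<bar>) \<le> (\<Sum>\<^sub>\<infinity>k. \<bar>infsum (triform u1 w w k) UNIV\<bar> + \<bar>infsum (triform w u2 w k) UNIV\<bar>)"
    using sn s le by (rule infsum_mono)
  also have "\<dots> = (\<Sum>\<^sub>\<infinity>k. \<bar>infsum (triform u1 w w k) UNIV\<bar>) + (\<Sum>\<^sub>\<infinity>k. \<bar>infsum (triform w u2 w k) UNIV\<bar>)"
    by (intro infsum_add d1 d2)
  also have "\<dots> \<le> 40 * sqrt (enstrophy w) * (enstrophy u1 + enstrophy w) + 40 * sqrt (enstrophy u2) * (enstrophy w + enstrophy w)"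
    by (intro add_mono order_trans[OF d1(3) t1(2)] order_trans[OF d2(3) t2(2)])
  finally show "(\<Sum>\<^sub>\<infinity>k. \<bar>?n k\<bar>) \<le>
      40 * sqrt (enstrophy w) * (enstrophy u1 + enstrophy w) + 40 * sqrt (enstrophy u2) * (enstrophy w + enstrophy w)" .
  show "\<bar>infsum ?n UNIV\<bar> \<le> 10 * sqrt (enstrophy u2) * (R * energy w + enstrophy w / R)" if R: "R \<ge> 1"
  proof -
    have a: "(\<lambda>k. infsum (triform u1 w w k) UNIV) summable_on UNIV"
      by (rule abs_summable_summable) (use d1(2) in simp)
    have b: "(\<lambda>k. infsum (triform w u2 w k) UNIV) summable_on UNIV"
      by (rule abs_summable_summable) (use d2(2) in simp)
    have "infsum ?n UNIV = (\<Sum>\<^sub>\<infinity>k. infsum (triform w u2 w k) UNIV)"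
      unfolding n using infsum_add[OF a b] d1(4) triform_cancel[OF in_V_imp_in_H[OF u1], of w] by simp
    also have "\<bar>\<dots>\<bar> \<le> (\<Sum>\<^sub>\<infinity>k. \<bar>infsum (triform w u2 w k) UNIV\<bar>)"
      using norm_infsum_bound[of "\<lambda>k. infsum (triform w u2 w k) UNIV" UNIV] d2(2) by simp
    also have "\<dots> \<le> (\<Sum>\<^sub>\<infinity>(k,p). \<bar>triform w u2 w k p\<bar>)" by (rule d2(3))
    also have "\<dots> \<le> 10 * sqrt (enstrophy u2) * (R * energy w + enstrophy w / R)"
      by (rule triform_summable_diag(2)[OF u2 w R])
    finally show ?thesis .
  qed
qed

section \<open>Energy balance and determining modes\<close>

lemma norm_mode_le:
  assumes "in_H u"
  shows "norm (u k) \<le> sqrt (energy u)"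
proof -
  have "(norm (u k))\<^sup>2 \<le> energy u"
    unfolding energy_def using finite_sum_le_infsum[OF in_H_summable[OF assms], of "{k}"] by simp
  then show ?thesis by (rule real_le_rsqrt)
qed

lemma strong_solD:
  assumes "strong_sol \<nu> f u u0"
  shows "0 \<le> t \<Longrightarrow> in_V (u t)"
    and "0 \<le> t \<Longrightarrow> ((\<lambda>s. f s k - (\<nu> * knorm2 k) *\<^sub>R u s k - Bop (u s) (u s) k)
           has_integral (u t k - u 0 k)) {0..t}"
  using assms unfolding strong_sol_def by blast+

text \<open>Reverse triangle inequality for the V norm. Continuity supplies the bounds on compact
  time intervals and the integrability of the enstrophy.\<close>

lemma continuous_on_sqrt_enstrophy:
  assumes "strong_sol \<nu> f u u0"
  shows "continuous_on {0..} (\<lambda>t. sqrt (enstrophy (u t)))"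
  unfolding continuous_on_def
proof
  fix t :: real assume t: "t \<in> {0..}"
  note V = strong_solD(1)[OF assms]
  have "((\<lambda>s. Vnorm (\<lambda>k. u s k - u t k) / (2 * pi)) \<longlongrightarrow> 0 / (2 * pi)) (at t within {0..})"
    using assms t unfolding strong_sol_def by (intro tendsto_divide tendsto_const) auto
  then have lim: "((\<lambda>s. sqrt (enstrophy (\<lambda>k. u s k - u t k))) \<longlongrightarrow> 0) (at t within {0..})"
    by (simp add: Vnorm_eq)
  have close: "\<bar>sqrt (enstrophy (u s)) - sqrt (enstrophy (u t))\<bar> \<le> sqrt (enstrophy (\<lambda>k. u s k - u t k))"
    if s: "s \<ge> 0" for s
  proof -
    have V': "in_V (u s)" "in_V (u t)" using V s t by auto
    have "sqrt (enstrophy (u t)) \<le> sqrt (enstrophy (u s)) + sqrt (enstrophy (\<lambda>k. u s k - u t k))"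
      using enstrophy_sqrt_triangle(1)[OF V'(1) in_V_diff[OF V']] by simp
    moreover have "sqrt (enstrophy (u s)) \<le> sqrt (enstrophy (u t)) + sqrt (enstrophy (\<lambda>k. u t k - u s k))"
      using enstrophy_sqrt_triangle(1)[OF V'(2) in_V_diff[OF V'(2,1)]] by simp
    moreover have "sqrt (enstrophy (\<lambda>k. u t k - u s k)) = sqrt (enstrophy (\<lambda>k. u s k - u t k))"
      by (simp add: enstrophy_def norm_minus_commute)
    ultimately show ?thesis by linarith
  qed
  have "((\<lambda>s. sqrt (enstrophy (u s)) - sqrt (enstrophy (u t))) \<longlongrightarrow> 0) (at t within {0..})"
    by (rule Lim_null_comparison[OF _ lim]) (use close in \<open>auto simp: eventually_at_filter\<close>)
  then show "((\<lambda>s. sqrt (enstrophy (u s))) \<longlongrightarrow> sqrt (enstrophy (u t))) (at t within {0..})"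
    by (rule Lim_null[THEN iffD2])
qed

lemma continuous_on_enstrophy:
  assumes "strong_sol \<nu> f u u0"
  shows "continuous_on {0..} (\<lambda>t. enstrophy (u t))"
proof -
  have "continuous_on {0..} (\<lambda>t. (sqrt (enstrophy (u t)))\<^sup>2)"
    by (intro continuous_on_power continuous_on_sqrt_enstrophy[OF assms])
  then show ?thesis by (simp add: enstrophy_nonneg)
qed

lemma enstrophy_locally_bounded:
  assumes "strong_sol \<nu> f u u0"
  obtains C where "0 \<le> C" "\<And>t. t \<in> {0..T} \<Longrightarrow> enstrophy (u t) \<le> C"
proof -
  have "continuous_on {0..T} (\<lambda>t. enstrophy (u t))"
    using continuous_on_enstrophy[OF assms] by (rule continuous_on_subset) auto
  then have "bounded ((\<lambda>t. enstrophy (u t)) ` {0..T})"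
    by (intro compact_imp_bounded compact_continuous_image compact_Icc)
  then obtain C where "\<forall>t\<in>{0..T}. \<bar>enstrophy (u t)\<bar> \<le> C"
    unfolding bounded_iff by auto
  then have "\<And>t. t \<in> {0..T} \<Longrightarrow> enstrophy (u t) \<le> max C 0" by fastforce
  then show thesis using that[of "max C 0"] by simp
qed

lemma in_Linf_energy_bound:
  assumes "in_Linf f"
  obtains F where "0 \<le> F" "\<And>t. 0 \<le> t \<Longrightarrow> sqrt (energy (f t)) \<le> F"
proof -
  obtain M where M: "\<And>t. 0 \<le> t \<Longrightarrow> Hnorm (f t) \<le> M" using assms unfolding in_Linf_def by blast
  have "sqrt (energy (f t)) \<le> M / (2 * pi)" if "0 \<le> t" for t
    using M[OF that] by (simp add: Hnorm_eq field_simps)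
  moreover have "0 \<le> M / (2 * pi)"
    using order_trans[OF real_sqrt_ge_zero[OF energy_nonneg] calculation[of 0]] by simp
  ultimately show thesis using that by blast
qed

text \<open>\<open>\<Phi>\<close> plays the role of the time derivative of the energy of the
  difference. \<open>R\<close> may be chosen afresh at each time \<open>r\<close>, so it can follow
  the size of \<open>u2 r\<close>. Constants are doubled because the energy itself, not its half, is
  balanced.\<close>

lemma energy_balance:
  assumes sol1: "strong_sol \<nu> f1 u1 u01" and sol2: "strong_sol \<nu> f2 u2 u02"
    and f1: "in_Linf f1" and f2: "in_Linf f2" and \<nu>: "0 < \<nu>"
  obtains \<Phi> where
    "\<And>s t. 0 \<le> s \<Longrightarrow> s \<le> t \<Longrightarrow>
      (\<Phi> has_integral (energy (\<lambda>k. u1 t k - u2 t k) - energy (\<lambda>k. u1 s k - u2 s k))) {s..t}"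
    and "\<And>T. \<exists>C. \<forall>r\<in>{0..T}. \<bar>\<Phi> r\<bar> \<le> C"
    and "\<And>r R. 0 \<le> r \<Longrightarrow> 1 \<le> R \<Longrightarrow> \<Phi> r \<le>
      2 * (sqrt (energy (\<lambda>k. f1 r k - f2 r k)) * sqrt (energy (\<lambda>k. u1 r k - u2 r k)))
      - 2 * \<nu> * enstrophy (\<lambda>k. u1 r k - u2 r k)
      + 20 * sqrt (enstrophy (u2 r)) * (R * energy (\<lambda>k. u1 r k - u2 r k) + enstrophy (\<lambda>k. u1 r k - u2 r k) / R)"
proof -
  define w where "w t = (\<lambda>k. u1 t k - u2 t k)" for t
  define g where "g t = (\<lambda>k. f1 t k - f2 t k)" for t
  \<comment> \<open>The right-hand side of the equation for mode \<open>k\<close> of the difference;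
    testing it with \<open>2 * w t k\<close> and summing over \<open>k\<close> gives
    \<open>\<Phi>\<close>.\<close>
  define h where "h t k = g t k - (\<nu> * knorm2 k) *\<^sub>R w t k - (Bop (u1 t) (u1 t) k - Bop (u2 t) (u2 t) k)" for t k
  define b where "b t k = inner (w t k) (Bop (u1 t) (u1 t) k - Bop (u2 t) (u2 t) k)" for t k
  define \<Phi> where "\<Phi> t = (\<Sum>\<^sub>\<infinity>k. 2 * inner (w t k) (h t k))" for t
  note V1 = strong_solD(1)[OF sol1] and V2 = strong_solD(1)[OF sol2]
  have w: "in_V (w t)" if "0 \<le> t" for t
    unfolding w_def using V1 V2 that by (intro in_V_diff) auto
  have g: "in_H (g t)" if "0 \<le> t" for t
    unfolding g_def using f1 f2 that by (intro in_H_diff) (auto simp: in_Linf_def)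
  have split: "2 * inner (w t k) (h t k) = 2 * inner (w t k) (g t k) + (- (2 * \<nu>) * (knorm2 k * (norm (w t k))\<^sup>2) + - 2 * b t k)" for t k
    by (simp add: h_def b_def inner_diff_right power2_norm_eq_inner)
  have b_sum: "(\<lambda>k. \<bar>b t k\<bar>) summable_on UNIV"
    "(\<Sum>\<^sub>\<infinity>k. \<bar>b t k\<bar>) \<le> 40 * sqrt (enstrophy (w t)) * (enstrophy (u1 t) + enstrophy (w t))
      + 40 * sqrt (enstrophy (u2 t)) * (enstrophy (w t) + enstrophy (w t))"
    "1 \<le> R \<Longrightarrow> \<bar>\<Sum>\<^sub>\<infinity>k. b t k\<bar> \<le> 10 * sqrt (enstrophy (u2 t)) * (R * energy (w t) + enstrophy (w t) / R)"
    if t: "0 \<le> t" for t R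
    using nonlinear_energy[OF V1[OF t] V2[OF t]] unfolding b_def w_def by blast+
  have gw_le: "\<bar>inner (w t k) (g t k)\<bar> \<le> \<bar>norm (w t k) * norm (g t k)\<bar>" for t k
    using Cauchy_Schwarz_ineq2[of "w t k" "g t k"] by simp
  have gw: "(\<lambda>k. \<bar>inner (w t k) (g t k)\<bar>) summable_on UNIV"
    "(\<Sum>\<^sub>\<infinity>k. \<bar>inner (w t k) (g t k)\<bar>) \<le> sqrt (energy (g t)) * sqrt (energy (w t))" if t: "0 \<le> t" for t
  proof -
    note cs = infsum_Cauchy_Schwarz[OF in_V_summable(1)[OF w[OF t]] in_H_summable[OF g[OF t]]]
    show s: "(\<lambda>k. \<bar>inner (w t k) (g t k)\<bar>) summable_on UNIV"
      using cs(1) gw_le by (rule summable_on_comparison_test) auto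
    have "(\<Sum>\<^sub>\<infinity>k. \<bar>inner (w t k) (g t k)\<bar>) \<le> (\<Sum>\<^sub>\<infinity>k. \<bar>norm (w t k) * norm (g t k)\<bar>)"
      using s cs(1) gw_le by (rule infsum_mono)
    also note cs(2)
    finally show "(\<Sum>\<^sub>\<infinity>k. \<bar>inner (w t k) (g t k)\<bar>) \<le> sqrt (energy (g t)) * sqrt (energy (w t))"
      by (simp add: energy_def mult.commute)
  qed
  have \<Phi>_eq: "\<Phi> t = 2 * (\<Sum>\<^sub>\<infinity>k. inner (w t k) (g t k)) - 2 * \<nu> * enstrophy (w t) - 2 * (\<Sum>\<^sub>\<infinity>k. b t k)" if t: "0 \<le> t" for t
  proof -
    have s1: "(\<lambda>k. inner (w t k) (g t k)) summable_on UNIV"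
      by (rule abs_summable_summable) (use gw(1)[OF t] in simp)
    have s3: "(\<lambda>k. b t k) summable_on UNIV"
      by (rule abs_summable_summable) (use b_sum(1)[OF t] in simp)
    note s2 = in_V_summable(2)[OF w[OF t]]
    have "((\<lambda>k. 2 * inner (w t k) (h t k)) has_sum
        (2 * (\<Sum>\<^sub>\<infinity>k. inner (w t k) (g t k)) + (- (2 * \<nu>) * enstrophy (w t) + - 2 * (\<Sum>\<^sub>\<infinity>k. b t k)))) UNIV"
      unfolding split enstrophy_def by (intro has_sum_add has_sum_cmult_right has_sum_infsum s1 s2 s3)
    from infsumI[OF this] show ?thesis by (simp add: \<Phi>_def)
  qed
  define A where "A t = 2 * (sqrt (energy (g t)) * sqrt (energy (w t))) + 2 * \<nu> * enstrophy (w t)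
     + 2 * (40 * sqrt (enstrophy (w t)) * (enstrophy (u1 t) + enstrophy (w t)) + 40 * sqrt (enstrophy (u2 t)) * (enstrophy (w t) + enstrophy (w t)))" for t
  have abs: "(\<lambda>k. \<bar>2 * inner (w t k) (h t k)\<bar>) summable_on UNIV"
    "(\<Sum>\<^sub>\<infinity>k. \<bar>2 * inner (w t k) (h t k)\<bar>) \<le> A t" if t: "0 \<le> t" for t
  proof -
    let ?d = "\<lambda>k. 2 * \<bar>inner (w t k) (g t k)\<bar> + (2 * \<nu> * (knorm2 k * (norm (w t k))\<^sup>2) + 2 * \<bar>b t k\<bar>)"
    note s = gw(1)[OF t] in_V_summable(2)[OF w[OF t]] b_sum(1)[OF t]
    have d: "?d summable_on UNIV" by (intro summable_on_add summable_on_cmult_right s)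
    have le: "\<bar>2 * inner (w t k) (h t k)\<bar> \<le> ?d k" for k
    proof -
      have "0 \<le> 2 * \<nu> * (knorm2 k * (norm (w t k))\<^sup>2)"
        using \<nu> by (simp add: knorm2_nonneg)
      then show ?thesis unfolding split by linarith
    qed
    show su: "(\<lambda>k. \<bar>2 * inner (w t k) (h t k)\<bar>) summable_on UNIV"
      using d le by (rule summable_on_comparison_test) auto
    have "(\<Sum>\<^sub>\<infinity>k. \<bar>2 * inner (w t k) (h t k)\<bar>) \<le> infsum ?d UNIV"
      using su d le by (rule infsum_mono)
    also have "\<dots> = 2 * (\<Sum>\<^sub>\<infinity>k. \<bar>inner (w t k) (g t k)\<bar>) + (2 * \<nu> * enstrophy (w t) + 2 * (\<Sum>\<^sub>\<infinity>k. \<bar>b t k\<bar>))"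
      unfolding enstrophy_def
      by (intro infsumI has_sum_add has_sum_cmult_right has_sum_infsum s)
    also have "\<dots> \<le> A t"
    proof -
      have "2 * p + (c + 2 * q) \<le> 2 * p' + c + 2 * q'" if "p \<le> p'" "q \<le> q'" for p p' q q' c :: real
        using that by simp
      then show ?thesis unfolding A_def using gw(2)[OF t] b_sum(2)[OF t] .
    qed
    finally show "(\<Sum>\<^sub>\<infinity>k. \<bar>2 * inner (w t k) (h t k)\<bar>) \<le> A t" .
  qed
  obtain F1 where F1: "0 \<le> F1" "\<And>t. 0 \<le> t \<Longrightarrow> sqrt (energy (f1 t)) \<le> F1" using in_Linf_energy_bound[OF f1] by blast
  obtain F2 where F2: "0 \<le> F2" "\<And>t. 0 \<le> t \<Longrightarrow> sqrt (energy (f2 t)) \<le> F2" using in_Linf_energy_bound[OF f2] by blast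
  have g_le: "sqrt (energy (g t)) \<le> F1 + F2" if t: "0 \<le> t" for t
  proof -
    have "sqrt (energy (g t)) \<le> sqrt (energy (f1 t)) + sqrt (energy (f2 t))"
      unfolding g_def using f1 f2 t by (intro energy_sqrt_triangle) (auto simp: in_Linf_def)
    then show ?thesis using F1(2)[OF t] F2(2)[OF t] by simp
  qed
  \<comment> \<open>Two kinds of bounds on \<open>{0..T}\<close>: \<open>C\<close> dominates the sum
    over all modes for the passage under the integral, while \<open>D k\<close> bounds the integrand
    of one mode for the product rule and may grow with \<open>knorm2 k\<close>.\<close>
  have bounds: "\<exists>C D. \<forall>t\<in>{0..T}. A t \<le> C \<and> (\<forall>k. norm (h t k) \<le> D k)" for T
  proof -
    obtain C1 where C1: "0 \<le> C1" "\<And>t. t \<in> {0..T} \<Longrightarrow> enstrophy (u1 t) \<le> C1"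
      using enstrophy_locally_bounded[OF sol1] by blast
    obtain C2 where C2: "0 \<le> C2" "\<And>t. t \<in> {0..T} \<Longrightarrow> enstrophy (u2 t) \<le> C2"
      using enstrophy_locally_bounded[OF sol2] by blast
    define S where "S = sqrt C1 + sqrt C2"
    have S0: "0 \<le> S" using C1 C2 by (simp add: S_def)
    define G where "G = F1 + F2"
    have G0: "0 \<le> G" using F1 F2 by (simp add: G_def)
    show ?thesis
    proof (intro exI ballI conjI allI)
      fix t assume t: "t \<in> {0..T}"
      then have t0: "0 \<le> t" by simp
      have "sqrt (enstrophy (w t)) \<le> sqrt (enstrophy (u1 t)) + sqrt (enstrophy (u2 t))"
        unfolding w_def by (rule enstrophy_sqrt_triangle[OF V1[OF t0] V2[OF t0]])
      also have "\<dots> \<le> S" unfolding S_def using C1(2)[OF t] C2(2)[OF t] by (intro add_mono) auto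
      finally have sw: "sqrt (enstrophy (w t)) \<le> S" .
      then have ew: "enstrophy (w t) \<le> S\<^sup>2"
        by (rule sqrt_le_D)
      have sew: "sqrt (energy (w t)) \<le> S"
        using energy_le_enstrophy[OF w[OF t0]] sw by (meson order_trans real_sqrt_le_mono)
      have gG: "sqrt (energy (g t)) \<le> G" unfolding G_def by (rule g_le[OF t0])
      show "A t \<le> 2 * (G * S) + 2 * \<nu> * S\<^sup>2 + 2 * (40 * S * (C1 + S\<^sup>2) + 40 * sqrt C2 * (S\<^sup>2 + S\<^sup>2))"
        unfolding A_def
        by (intro add_mono mult_mono mult_left_mono ew sw sew gG C1(2)[OF t] real_sqrt_le_mono C2(2)[OF t] order_refl)
           (use \<nu> S0 G0 C1 C2 in \<open>auto simp: energy_nonneg enstrophy_nonneg\<close>)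
      fix k
      have "norm (h t k) \<le> norm (g t k) + \<nu> * knorm2 k * norm (w t k) + (norm (Bop (u1 t) (u1 t) k) + norm (Bop (u2 t) (u2 t) k))"
      proof -
        have "norm (h t k) \<le> norm (g t k - (\<nu> * knorm2 k) *\<^sub>R w t k) + norm (Bop (u1 t) (u1 t) k - Bop (u2 t) (u2 t) k)"
          unfolding h_def by (rule norm_triangle_ineq4)
        moreover have "norm (g t k - (\<nu> * knorm2 k) *\<^sub>R w t k) \<le> norm (g t k) + \<nu> * knorm2 k * norm (w t k)"
          using norm_triangle_ineq4[of "g t k" "(\<nu> * knorm2 k) *\<^sub>R w t k"] \<nu>
          by (simp add: knorm2_nonneg abs_mult)
        ultimately show ?thesis using norm_triangle_ineq4[of "Bop (u1 t) (u1 t) k" "Bop (u2 t) (u2 t) k"] by linarith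
      qed
      also have "\<dots> \<le> G + \<nu> * knorm2 k * S + (2 * C1 + 2 * C2)"
      proof (intro add_mono mult_left_mono)
        show "norm (g t k) \<le> G" using norm_mode_le[OF g[OF t0]] gG by (rule order_trans)
        show "norm (w t k) \<le> S" using norm_mode_le[OF in_V_imp_in_H[OF w[OF t0]]] sew by (rule order_trans)
        show "norm (Bop (u1 t) (u1 t) k) \<le> 2 * C1" using norm_Bop_le[OF V1[OF t0], of k] C1(2)[OF t] by linarith
        show "norm (Bop (u2 t) (u2 t) k) \<le> 2 * C2" using norm_Bop_le[OF V2[OF t0], of k] C2(2)[OF t] by linarith
      qed (use \<nu> in \<open>simp add: knorm2_nonneg\<close>)
      finally show "norm (h t k) \<le> G + \<nu> * knorm2 k * S + (2 * C1 + 2 * C2)" .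
    qed
  qed
  have eq: "((\<lambda>r. h r k) has_integral (w t k - w 0 k)) {0..t}" if "0 \<le> t" for t k
    using has_integral_diff[OF strong_solD(2)[OF sol1 that, of k] strong_solD(2)[OF sol2 that, of k]]
    by (simp add: h_def w_def g_def algebra_simps)
  show thesis
  proof (rule that)
    show "(\<Phi> has_integral (energy (\<lambda>k. u1 t k - u2 t k) - energy (\<lambda>k. u1 s k - u2 s k))) {s..t}"
      if st: "0 \<le> s" "s \<le> t" for s t
    proof -
      obtain C D where CD: "\<And>r. r \<in> {0..t} \<Longrightarrow> A r \<le> C" "\<And>r k. r \<in> {0..t} \<Longrightarrow> norm (h r k) \<le> D k"
        using bounds[of t] by blast
      have t0: "0 \<le> t" using st by simp
      have mode: "((\<lambda>r. 2 * inner (w r k) (h r k)) has_integral ((norm (w t k))\<^sup>2 - (norm (w s k))\<^sup>2)) {s..t}" for k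
      proof -
        have inc: "((\<lambda>r. h r k) has_integral (w r k - w s k)) {s..r}" if "r \<in> {s..t}" for r
          by (rule has_integral_increment[where a=0 and b=t and x="\<lambda>r. w r k"]) (use eq st that in auto)
        have "((\<lambda>r. inner (h r k) (w r k) + inner (w r k) (h r k)) has_integral
            (inner (w t k) (w t k) - inner (w s k) (w s k))) {s..t}"
          by (rule has_integral_bilinear_product[OF bounded_bilinear_inner st(2) inc inc, where C="D k" and D="D k"])
             (use CD(2) st in auto)
        then show ?thesis by (simp add: inner_commute power2_norm_eq_inner)
      qed
      note st1 = in_V_summable(1)[OF w[OF t0]] and ss1 = in_V_summable(1)[OF w[OF st(1)]]
      have hs: "((\<lambda>k. (norm (w t k))\<^sup>2 - (norm (w s k))\<^sup>2) has_sum (energy (w t) - energy (w s))) UNIV"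
        using has_sum_add[OF has_sum_infsum[OF st1] has_sum_uminusI[OF has_sum_infsum[OF ss1]]]
        by (simp add: energy_def)
      have "(\<Phi> has_integral (\<Sum>\<^sub>\<infinity>k. (norm (w t k))\<^sup>2 - (norm (w s k))\<^sup>2)) {s..t}"
        unfolding \<Phi>_def
      proof (rule has_integral_infsum[OF mode, where C=C])
        show "(\<lambda>k. (norm (w t k))\<^sup>2 - (norm (w s k))\<^sup>2) summable_on UNIV"
          using hs by (rule has_sum_imp_summable)
        fix r assume "r \<in> {s..t}"
        then have r: "0 \<le> r" "r \<in> {0..t}" using st by auto
        show "(\<lambda>k. \<bar>2 * inner (w r k) (h r k)\<bar>) summable_on UNIV" by (rule abs(1)[OF r(1)])
        show "(\<Sum>\<^sub>\<infinity>k. \<bar>2 * inner (w r k) (h r k)\<bar>) \<le> C" using abs(2)[OF r(1)] CD(1)[OF r(2)] by simp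
      qed
      then show ?thesis using infsumI[OF hs] by (simp add: w_def)
    qed
    show "\<exists>C. \<forall>r\<in>{0..T}. \<bar>\<Phi> r\<bar> \<le> C" for T
    proof -
      obtain C where C: "\<And>r. r \<in> {0..T} \<Longrightarrow> A r \<le> C" using bounds[of T] by blast
      have "\<bar>\<Phi> r\<bar> \<le> C" if r: "r \<in> {0..T}" for r
      proof -
        have r0: "0 \<le> r" using r by simp
        have "\<bar>\<Phi> r\<bar> \<le> (\<Sum>\<^sub>\<infinity>k. \<bar>2 * inner (w r k) (h r k)\<bar>)"
          unfolding \<Phi>_def using norm_infsum_bound[of "\<lambda>k. 2 * inner (w r k) (h r k)" UNIV] abs(1)[OF r0]
          by (simp only: real_norm_def)
        then show ?thesis using abs(2)[OF r0] C[OF r] by linarith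
      qed
      then show ?thesis by blast
    qed
    show "\<Phi> r \<le> 2 * (sqrt (energy (\<lambda>k. f1 r k - f2 r k)) * sqrt (energy (\<lambda>k. u1 r k - u2 r k)))
      - 2 * \<nu> * enstrophy (\<lambda>k. u1 r k - u2 r k)
      + 20 * sqrt (enstrophy (u2 r)) * (R * energy (\<lambda>k. u1 r k - u2 r k) + enstrophy (\<lambda>k. u1 r k - u2 r k) / R)"
      if r: "0 \<le> r" and R: "1 \<le> R" for r R
    proof -
      have "\<bar>\<Sum>\<^sub>\<infinity>k. inner (w r k) (g r k)\<bar> \<le> sqrt (energy (g r)) * sqrt (energy (w r))"
        using norm_infsum_bound[of "\<lambda>k. inner (w r k) (g r k)" UNIV] gw[OF r] by simp
      then show ?thesis
        using \<Phi>_eq[OF r] b_sum(3)[OF r R] unfolding w_def g_def by linarith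
    qed
  qed
qed

lemma strong_sol_zero: "strong_sol \<nu> (\<lambda>_ _. 0) (\<lambda>_ _. 0) (\<lambda>_. 0)"
proof -
  have "in_V (\<lambda>_. 0)"
    by (simp add: in_V_def in_H_def kdot_def pconj_def cnorm2_def zero_prod_def)
  moreover have "Bop (\<lambda>_. 0) (\<lambda>_. 0) k = 0" for k
    by (simp add: Bop_def leray_def convect_def kdot_def zero_prod_def)
  ultimately show ?thesis
    by (simp add: strong_sol_def Vnorm_eq enstrophy_def DAnorm2_def cnorm2_def)
qed

lemma in_Linf_zero: "in_Linf (\<lambda>_ _. 0)"
  by (simp add: in_Linf_def in_H_def kdot_def pconj_def cnorm2_def Hnorm_def zero_prod_def set_borel_measurable_def
      exI[of _ "0::real"])

text \<open>The energy balance for \<open>u\<close> is that of the difference of \<open>u\<close> and the zero solution.\<close>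
lemma solution_bounds:
  assumes sol: "strong_sol \<nu> f u u0" and f: "in_Linf f" and \<nu>: "0 < \<nu>"
    and F: "\<And>t. 0 \<le> t \<Longrightarrow> sqrt (energy (f t)) \<le> F"
  obtains M where "\<And>t. 0 \<le> t \<Longrightarrow> energy (u t) \<le> M"
    and "\<And>s t. 0 \<le> s \<Longrightarrow> s \<le> t \<Longrightarrow> integral {s..t} (\<lambda>r. enstrophy (u r)) \<le> (M + F\<^sup>2 / \<nu> * (t - s)) / \<nu>"
proof -
  have zero: "enstrophy (\<lambda>_. 0) = 0" by (simp add: enstrophy_def)
  obtain \<Phi> where int: "\<And>s t. 0 \<le> s \<Longrightarrow> s \<le> t \<Longrightarrow>
      (\<Phi> has_integral (energy (\<lambda>k. u t k - 0) - energy (\<lambda>k. u s k - 0))) {s..t}"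
    and bdd: "\<And>T. \<exists>C. \<forall>r\<in>{0..T}. \<bar>\<Phi> r\<bar> \<le> C"
    and bound: "\<And>r R. 0 \<le> r \<Longrightarrow> 1 \<le> R \<Longrightarrow> \<Phi> r \<le>
      2 * (sqrt (energy (\<lambda>k. f r k - 0)) * sqrt (energy (\<lambda>k. u r k - 0)))
      - 2 * \<nu> * enstrophy (\<lambda>k. u r k - 0)
      + 20 * sqrt (enstrophy (\<lambda>_. 0)) * (R * energy (\<lambda>k. u r k - 0) + enstrophy (\<lambda>k. u r k - 0) / R)"
    by (rule energy_balance[OF sol strong_sol_zero f in_Linf_zero \<nu>]) blast
  have \<Phi>: "(\<Phi> has_integral (energy (u t) - energy (u s))) {s..t}" if "0 \<le> s" "s \<le> t" for s t
    using int[OF that] by simp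
  have le: "\<Phi> r \<le> 2 * (sqrt (energy (f r)) * sqrt (energy (u r))) - 2 * \<nu> * enstrophy (u r)" if "0 \<le> r" for r
    using bound[OF that order_refl] by (simp add: zero)
  \<comment> \<open>Young's inequality spends one \<nu> of the dissipation, which Poincare converts
    into |u|^2; the other \<nu> is kept for the time average of the enstrophy.\<close>
  have le': "\<Phi> r \<le> F\<^sup>2 / \<nu> - \<nu> * enstrophy (u r)" if r: "0 \<le> r" for r
  proof -
    let ?y = "sqrt (energy (u r))"
    have y: "?y\<^sup>2 \<le> enstrophy (u r)"
      using energy_le_enstrophy[OF strong_solD(1)[OF sol r]] by (simp add: energy_nonneg)
    have "sqrt (energy (f r)) * ?y \<le> F * ?y" using F[OF r] by (intro mult_right_mono) (auto simp: energy_nonneg)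
    moreover have "2 * (F * ?y) \<le> F\<^sup>2 / \<nu> + \<nu> * ?y\<^sup>2"
    proof -
      have "0 \<le> (F - \<nu> * ?y)\<^sup>2 / \<nu>" using \<nu> by simp
      also have "\<dots> = F\<^sup>2 / \<nu> + \<nu> * ?y\<^sup>2 - 2 * (F * ?y)"
        using \<nu> by (simp add: power2_diff field_simps power2_eq_square)
      finally show ?thesis by simp
    qed
    moreover have "\<nu> * ?y\<^sup>2 \<le> \<nu> * enstrophy (u r)" using y \<nu> by (intro mult_left_mono) auto
    ultimately show ?thesis using le[OF r] by linarith
  qed
  \<comment> \<open>Gronwall with constant rate \<nu> and \<open>L = 0\<close>. \<open>M\<close>
    depends on the initial value, but the coefficient of \<open>t - s\<close> in the integral bound
    does not, which makes a choice of \<open>N\<close> uniform in the data possible.\<close>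
  define M where "M = energy (u 0) + F\<^sup>2 / \<nu> / \<nu>"
  have M: "energy (u t) \<le> M" if t: "0 \<le> t" for t
  proof -
    have "energy (u t) \<le> exp 0 * (exp (- (\<nu> * (t - 0))) * energy (u 0) + F\<^sup>2 / \<nu> / \<nu>)"
    proof (rule gronwall_bound[where a="\<lambda>_. \<nu>" and \<Phi>=\<Phi>, OF \<Phi> bdd])
      fix r :: real assume r: "0 \<le> r"
      have "\<nu> * energy (u r) \<le> \<nu> * enstrophy (u r)"
        using energy_le_enstrophy[OF strong_solD(1)[OF sol r]] \<nu> by simp
      then show "\<Phi> r \<le> F\<^sup>2 / \<nu> - \<nu> * energy (u r)" using le'[OF r] by simp
    qed (use \<nu> t in \<open>auto simp: energy_nonneg\<close>)
    also have "\<dots> \<le> M"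
      using \<nu> t mult_right_mono[OF _ energy_nonneg, of "exp (- (\<nu> * t))" 1 "u 0"] by (simp add: M_def)
    finally show ?thesis .
  qed
  show thesis
  proof (rule that[OF M])
    fix s t :: real assume st: "0 \<le> s" "s \<le> t"
    have "continuous_on {s..t} (\<lambda>r. enstrophy (u r))"
      using continuous_on_enstrophy[OF sol] by (rule continuous_on_subset) (use st in auto)
    then have "((\<lambda>r. enstrophy (u r)) has_integral integral {s..t} (\<lambda>r. enstrophy (u r))) {s..t}"
      by (intro integrable_integral integrable_continuous_real)
    then have "((\<lambda>r. F\<^sup>2 / \<nu> - \<nu> * enstrophy (u r)) has_integral
        (t - s) * (F\<^sup>2 / \<nu>) - \<nu> * integral {s..t} (\<lambda>r. enstrophy (u r))) {s..t}"
      using has_integral_const_real[of "F\<^sup>2 / \<nu>" s t] st by (intro has_integral_diff has_integral_mult_right) auto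
    with \<Phi>[OF st] have "energy (u t) - energy (u s) \<le> (t - s) * (F\<^sup>2 / \<nu>) - \<nu> * integral {s..t} (\<lambda>r. enstrophy (u r))"
      by (rule has_integral_le) (use le' st in auto)
    then have "\<nu> * integral {s..t} (\<lambda>r. enstrophy (u r)) \<le> M + F\<^sup>2 / \<nu> * (t - s)"
      using M[OF st(1)] energy_nonneg[of "u t"] by (simp add: mult.commute)
    then show "integral {s..t} (\<lambda>r. enstrophy (u r)) \<le> (M + F\<^sup>2 / \<nu> * (t - s)) / \<nu>"
      using \<nu> by (simp add: pos_le_divide_eq mult.commute)
  qed
qed

text \<open>The lower bound on the integrals of \<open>a\<close> has the same \<open>L\<close> for
  every starting time, so Gronwall can be restarted at a late \<open>s\<close> where the forcing
  \<open>\<beta>\<close> is already small; the contribution of \<open>y s\<close> then decays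
  exponentially.\<close>

lemma tendsto_zero_if_gronwall:
  fixes y \<Phi> a \<beta> :: "real \<Rightarrow> real"
  assumes y: "\<And>s t. 0 \<le> s \<Longrightarrow> s \<le> t \<Longrightarrow> (\<Phi> has_integral (y t - y s)) {s..t}"
    and bdd: "\<And>T. \<exists>C. \<forall>r\<in>{0..T}. \<bar>\<Phi> r\<bar> \<le> C"
    and a: "continuous_on {0..} a"
    and lower: "\<And>s t. 0 \<le> s \<Longrightarrow> s \<le> t \<Longrightarrow> \<delta> * (t - s) - L \<le> integral {s..t} a"
    and \<delta>: "0 < \<delta>" and y_nonneg: "\<And>t. 0 \<le> y t"
    and \<Phi>: "\<And>r. 0 \<le> r \<Longrightarrow> \<Phi> r \<le> \<beta> r - a r * y r"
    and \<beta>: "(\<beta> \<longlongrightarrow> 0) at_top"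
  shows "(y \<longlongrightarrow> 0) at_top"
proof (rule tendstoI)
  fix \<epsilon> :: real assume \<epsilon>: "0 < \<epsilon>"
  \<comment> \<open>Chosen so that \<open>exp L * (B / \<delta>)\<close> equals
    \<open>\<epsilon> / 2\<close>.\<close>
  define B where "B = \<delta> * \<epsilon> / (2 * exp L)"
  have B: "0 < B" using \<delta> \<epsilon> by (simp add: B_def)
  have "eventually (\<lambda>r. \<beta> r < B) at_top" using \<beta> B by (rule order_tendstoD(2))
  then obtain s0 where s0: "\<And>r. s0 \<le> r \<Longrightarrow> \<beta> r < B" unfolding eventually_at_top_linorder by blast
  define s where "s = max s0 0"
  have s: "0 \<le> s" "s0 \<le> s" by (auto simp: s_def)
  have le: "y t \<le> exp L * (exp (- (\<delta> * (t - s))) * y s) + \<epsilon> / 2" if "s \<le> t" for t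
  proof -
    have "y t \<le> exp L * (exp (- (\<delta> * (t - s))) * y s + B / \<delta>)"
    proof (rule gronwall_bound[OF y bdd a lower \<delta> less_imp_le[OF B] y_nonneg s(1) that])
      fix r assume "s \<le> r"
      then show "\<Phi> r \<le> B - a r * y r" using \<Phi>[of r] s0[of r] s by simp
    qed
    then show ?thesis using \<delta> by (simp add: B_def distrib_left)
  qed
  have "filterlim (\<lambda>t. \<delta> * (- s + t)) at_top at_top"
    by (intro filterlim_tendsto_pos_mult_at_top[OF tendsto_const \<delta>]
        filterlim_tendsto_add_at_top[OF tendsto_const filterlim_ident])
  then have "filterlim (\<lambda>t. - (\<delta> * (t - s))) at_bot at_top"
    by (simp add: filterlim_uminus_at_bot)
  then have "((\<lambda>t. exp (- (\<delta> * (t - s)))) \<longlongrightarrow> 0) at_top"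
    by (rule filterlim_compose[OF exp_at_bot])
  then have "((\<lambda>t. exp L * (exp (- (\<delta> * (t - s))) * y s)) \<longlongrightarrow> exp L * (0 * y s)) at_top"
    by (intro tendsto_intros)
  then have "eventually (\<lambda>t. exp L * (exp (- (\<delta> * (t - s))) * y s) < \<epsilon> / 2) at_top"
    using \<epsilon> by (intro order_tendstoD(2)) auto
  moreover have "eventually (\<lambda>t. s \<le> t) at_top" by (rule eventually_ge_at_top)
  ultimately show "eventually (\<lambda>t. dist (y t) 0 < \<epsilon>) at_top"
    by eventually_elim (use le y_nonneg in \<open>fastforce simp: dist_real_def\<close>)
qed

section \<open>Choice of N and the limit argument\<close>

theorem determining_modes:
  assumes \<nu>: "0 < \<nu>"
  shows "finite_determining_modes \<nu>"
  unfolding finite_determining_modes_def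
proof (intro allI impI)
  fix f1 f2 assume f1: "in_Linf f1" and f2: "in_Linf f2"
  obtain F1 where F1: "\<And>t. 0 \<le> t \<Longrightarrow> sqrt (energy (f1 t)) \<le> F1" using in_Linf_energy_bound[OF f1] by blast
  obtain F where F: "\<And>t. 0 \<le> t \<Longrightarrow> sqrt (energy (f2 t)) \<le> F" using in_Linf_energy_bound[OF f2] by blast
  \<comment> \<open>Since sqrt E \<le> 1 + E, the loss \<open>20 * sqrt E + 400 / \<nu> * E\<close>
    caused by the trilinear term is at most \<open>20 + Q * E\<close>.\<close>
  define Q where "Q = 20 + 400 / \<nu>"
  have Q: "0 < Q" using \<nu> by (simp add: Q_def add_pos_pos)
  \<comment> \<open>Then \<open>\<nu> * N\<^sup>2\<close> consists of 20 for the constant part of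
    that loss, \<open>Q\<close> times the bound \<open>F\<^sup>2 / \<nu> / \<nu>\<close> on the
    long-time mean of the enstrophy, and 1 as net decay rate in Gronwall's lemma.\<close>
  define N where "N = sqrt ((21 + Q * (F\<^sup>2 / \<nu> / \<nu>)) / \<nu>)"
  have pos: "0 < 21 + Q * (F\<^sup>2 / \<nu> / \<nu>)" using Q \<nu> by (intro add_pos_nonneg) auto
  then have N: "0 < N" using \<nu> by (simp add: N_def)
  have N2: "\<nu> * N\<^sup>2 = 21 + Q * (F\<^sup>2 / \<nu> / \<nu>)" using pos \<nu> by (simp add: N_def)
  show "\<exists>N>0. \<forall>u01 u02 u1 u2. in_V u01 \<longrightarrow> in_V u02 \<longrightarrow>
           strong_sol \<nu> f1 u1 u01 \<longrightarrow> strong_sol \<nu> f2 u2 u02 \<longrightarrow>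
           ((\<lambda>t. Hnorm (\<lambda>k. PN N (u1 t) k - PN N (u2 t) k)) \<longlongrightarrow> 0) at_top \<longrightarrow>
           ((\<lambda>t. Hnorm (\<lambda>k. f1 t k - f2 t k)) \<longlongrightarrow> 0) at_top \<longrightarrow>
           ((\<lambda>t. Hnorm (\<lambda>k. u1 t k - u2 t k)) \<longlongrightarrow> 0) at_top"
  proof (intro exI[of _ N] conjI N allI impI)
    fix u01 u02 u1 u2
    assume sol1: "strong_sol \<nu> f1 u1 u01" and sol2: "strong_sol \<nu> f2 u2 u02"
      and P0: "((\<lambda>t. Hnorm (\<lambda>k. PN N (u1 t) k - PN N (u2 t) k)) \<longlongrightarrow> 0) at_top"
      and g0: "((\<lambda>t. Hnorm (\<lambda>k. f1 t k - f2 t k)) \<longlongrightarrow> 0) at_top"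
    define y where "y t = energy (\<lambda>k. u1 t k - u2 t k)" for t
    define D where "D t = enstrophy (\<lambda>k. u1 t k - u2 t k)" for t
    define p where "p t = energy (\<lambda>k. PN N (u1 t) k - PN N (u2 t) k)" for t
    define g where "g t = sqrt (energy (\<lambda>k. f1 t k - f2 t k))" for t
    define E where "E t = enstrophy (u2 t)" for t
    have E0: "0 \<le> E t" for t by (simp add: E_def enstrophy_nonneg)
    have y0: "0 \<le> y t" for t by (simp add: y_def energy_nonneg)
    have D0: "0 \<le> D t" for t by (simp add: D_def enstrophy_nonneg)
    have g_nn: "0 \<le> g t" for t by (simp add: g_def energy_nonneg)
    have "((\<lambda>t. (Hnorm (\<lambda>k. PN N (u1 t) k - PN N (u2 t) k) / (2 * pi))\<^sup>2) \<longlongrightarrow> (0 / (2 * pi))\<^sup>2) at_top"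
      by (intro tendsto_intros P0) simp
    then have p_lim: "(p \<longlongrightarrow> 0) at_top" by (simp add: Hnorm_eq energy_nonneg p_def[abs_def])
    have "((\<lambda>t. Hnorm (\<lambda>k. f1 t k - f2 t k) / (2 * pi)) \<longlongrightarrow> 0 / (2 * pi)) at_top"
      by (intro tendsto_intros g0) simp
    then have g_lim: "(g \<longlongrightarrow> 0) at_top" by (simp add: Hnorm_eq g_def[abs_def])
    obtain M1 where M1: "\<And>t. 0 \<le> t \<Longrightarrow> energy (u1 t) \<le> M1"
      by (rule solution_bounds[OF sol1 f1 \<nu> F1]) blast+
    obtain M where M: "\<And>t. 0 \<le> t \<Longrightarrow> energy (u2 t) \<le> M"
      and IE: "\<And>s t. 0 \<le> s \<Longrightarrow> s \<le> t \<Longrightarrow> integral {s..t} E \<le> (M + F\<^sup>2 / \<nu> * (t - s)) / \<nu>"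
      unfolding E_def by (rule solution_bounds[OF sol2 f2 \<nu> F]) blast+
    \<comment> \<open>The force difference enters the balance multiplied by |w|; a bound on |w| for
      all times makes this product tend to 0 together with \<open>g\<close>.\<close>
    define Y where "Y = sqrt M1 + sqrt M"
    have y_le: "sqrt (y t) \<le> Y" if t: "0 \<le> t" for t
    proof -
      have "sqrt (y t) \<le> sqrt (energy (u1 t)) + sqrt (energy (u2 t))"
        unfolding y_def by (intro energy_sqrt_triangle in_V_imp_in_H strong_solD(1)[OF sol1 t] strong_solD(1)[OF sol2 t])
      also have "\<dots> \<le> Y" unfolding Y_def by (intro add_mono real_sqrt_le_mono M1 M t)
      finally show ?thesis .
    qed
    obtain \<Phi> where int: "\<And>s t. 0 \<le> s \<Longrightarrow> s \<le> t \<Longrightarrow> (\<Phi> has_integral (y t - y s)) {s..t}"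
      and bdd: "\<And>T. \<exists>C. \<forall>r\<in>{0..T}. \<bar>\<Phi> r\<bar> \<le> C"
      and bound: "\<And>r R. 0 \<le> r \<Longrightarrow> 1 \<le> R \<Longrightarrow> \<Phi> r \<le>
        2 * (g r * sqrt (y r)) - 2 * \<nu> * D r + 20 * sqrt (E r) * (R * y r + D r / R)"
      unfolding y_def D_def g_def E_def by (rule energy_balance[OF sol1 sol2 f1 f2 \<nu>]) blast
    \<comment> \<open>Damping of the high modes minus the trilinear loss; \<open>\<beta>\<close>
      collects the force difference and the low modes, both of which tend to 0. The coefficient
      \<open>400 / \<nu>\<close> is 20 times the \<open>20 / \<nu>\<close> in the later choice of
      \<open>R\<close>.\<close>
    define a where "a t = \<nu> * N\<^sup>2 - (20 * sqrt (E t) + 400 / \<nu> * E t)" for t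
    define \<beta> where "\<beta> t = 2 * (g t * Y) + \<nu> * N\<^sup>2 * p t" for t
    have cE: "continuous_on {0..} E" and csE: "continuous_on {0..} (\<lambda>t. sqrt (E t))"
      unfolding E_def using continuous_on_enstrophy[OF sol2] continuous_on_sqrt_enstrophy[OF sol2] by auto
    have a_cont: "continuous_on {0..} a"
      unfolding a_def by (intro continuous_intros cE csE)
    have "(y \<longlongrightarrow> 0) at_top"
    proof (rule tendsto_zero_if_gronwall[where \<Phi>=\<Phi> and a=a and \<beta>=\<beta> and \<delta>=1 and L="Q * M / \<nu>", OF int bdd a_cont _ zero_less_one y0])
      fix s t :: real assume st: "0 \<le> s" "s \<le> t"
      have sub: "{s..t} \<subseteq> {0..}" using st by auto
      have iE: "E integrable_on {s..t}"
        by (intro integrable_continuous_real continuous_on_subset[OF cE sub])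
      \<comment> \<open>By the choice of \<open>N\<close> the two sides are equal; the initial data
        survive only in \<open>Q * M / \<nu>\<close>.\<close>
      have "1 * (t - s) - Q * M / \<nu> \<le> (t - s) * (\<nu> * N\<^sup>2 - 20) - Q * ((M + F\<^sup>2 / \<nu> * (t - s)) / \<nu>)"
        unfolding N2 using \<nu> by (simp add: field_simps)
      also have "\<dots> \<le> (t - s) * (\<nu> * N\<^sup>2 - 20) - Q * integral {s..t} E"
        using IE[OF st] Q by (intro diff_left_mono mult_left_mono) auto
      also have "\<dots> \<le> integral {s..t} a"
      proof (rule has_integral_le)
        show "((\<lambda>r. (\<nu> * N\<^sup>2 - 20) - Q * E r) has_integral (t - s) * (\<nu> * N\<^sup>2 - 20) - Q * integral {s..t} E) {s..t}"
          using has_integral_const_real[of "\<nu> * N\<^sup>2 - 20" s t] st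
          by (intro has_integral_diff has_integral_mult_right integrable_integral iE) auto
        show "(a has_integral integral {s..t} a) {s..t}"
          by (intro integrable_integral integrable_continuous_real continuous_on_subset[OF a_cont sub])
        fix r
        have "sqrt (E r) \<le> 1 + E r"
          using E0[of r] by (intro real_le_lsqrt) (auto simp: power2_eq_square algebra_simps)
        then show "(\<nu> * N\<^sup>2 - 20) - Q * E r \<le> a r"
          by (simp add: a_def Q_def algebra_simps)
      qed
      finally show "1 * (t - s) - Q * M / \<nu> \<le> integral {s..t} a" .
    next
      fix r :: real assume r: "0 \<le> r"
      \<comment> \<open>chosen so that \<open>20 sqrt (E r) / R \<le> \<nu>\<close>, i.e. half of the dissipation absorbs the gradient of \<open>w\<close>\<close>
      define R where "R = 1 + 20 * sqrt (E r) / \<nu>"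
      have R1: "1 \<le> R" using \<nu> E0[of r] by (simp add: R_def)
      have "20 * sqrt (E r) \<le> \<nu> * R" using \<nu> by (simp add: R_def distrib_left)
      then have "20 * sqrt (E r) / R \<le> \<nu>" using R1 by (simp add: pos_divide_le_eq)
      then have "20 * sqrt (E r) / R * D r \<le> \<nu> * D r" using D0 by (rule mult_right_mono)
      moreover have "20 * sqrt (E r) * (R * y r) = (20 * sqrt (E r) + 400 / \<nu> * E r) * y r"
      proof -
        have "sqrt (E r) * sqrt (E r) = E r" using E0 by simp
        then have "20 * sqrt (E r) * R = 20 * sqrt (E r) + 400 / \<nu> * E r"
          by (simp add: R_def distrib_left)
        then show ?thesis by (metis mult.assoc)
      qed
      moreover have "g r * sqrt (y r) \<le> g r * Y" using y_le[OF r] g_nn by (rule mult_left_mono)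
      \<comment> \<open>The remaining half of the dissipation provides the damping of the high
        modes.\<close>
      moreover have "\<nu> * (N\<^sup>2 * (y r - p r)) \<le> \<nu> * D r"
        unfolding y_def p_def D_def using \<nu> N
        by (intro mult_left_mono high_modes_bound strong_solD(1)[OF sol1 r] strong_solD(1)[OF sol2 r]) auto
      moreover have "\<Phi> r \<le> 2 * (g r * sqrt (y r)) - 2 * \<nu> * D r + (20 * sqrt (E r) * (R * y r) + 20 * sqrt (E r) / R * D r)"
        using bound[OF r R1] by (simp add: distrib_left)
      ultimately have "\<Phi> r \<le> 2 * (g r * Y) - \<nu> * (N\<^sup>2 * (y r - p r)) + (20 * sqrt (E r) + 400 / \<nu> * E r) * y r"
        by linarith
      then show "\<Phi> r \<le> \<beta> r - a r * y r"
        by (simp add: \<beta>_def a_def algebra_simps)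
    next
      have "((\<lambda>t. 2 * (g t * Y) + \<nu> * N\<^sup>2 * p t) \<longlongrightarrow> 2 * (0 * Y) + \<nu> * N\<^sup>2 * 0) at_top"
        by (intro tendsto_intros g_lim p_lim)
      then show "(\<beta> \<longlongrightarrow> 0) at_top" by (simp add: \<beta>_def[abs_def])
    qed
    then have "((\<lambda>t. 2 * pi * sqrt (y t)) \<longlongrightarrow> 2 * pi * sqrt 0) at_top"
      by (intro tendsto_intros)
    then show "((\<lambda>t. Hnorm (\<lambda>k. u1 t k - u2 t k)) \<longlongrightarrow> 0) at_top"
      by (simp add: Hnorm_eq y_def)
  qed
qed

theorem theorem4p6:
  fixes \<nu> :: real
  assumes "\<nu> > 0"
    and "synchronization_property \<nu>"
  shows "finite_determining_modes \<nu>"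
  using assms(1) by (rule determining_modes)

end
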